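(* Let $r\ge 2$, let $n\ge 2$, and let $\lambda=(\lambda_1,\ldots,\lambda_r)\vDash n$ be an $r$-part composition with $\lambda_r=1$. Let $\lambda_*=(\lambda_1,\ldots,\lambda_r,1)\vDash n+1$. Then the mapping $\theta_*\colon Y(\lambda)\to Y(\lambda_* )$, given by $w_D\mapsto w_{D\psi}$ for $D\in\mathcal E^{(\lambda)}$, is a bijection.
   Context: A composition $\lambda=(\lambda_1,\ldots,\lambda_r)$ of $n$ ($\lambda\vDash n$) is a finite sequence of positive integers with sum $n$; its conjugate is the partition $\lambda'$ with $\lambda'_i=|\{j : i\le\lambda_j\}|$ for $1\le i\le\max_j\lambda_j$. $S_n$ acts on the right on $\{1,\ldots,n\}$ (products are composed left to right), with Coxeter generators $S=\{s_1,\ldots,s_{n-1}\}$, $s_i=(i,i+1)$, and Coxeter length $l$. An element $x$ is a prefix of $y$ if $y$ has a reduced expression beginning with a reduced expression for $x$ (equivalently $l(y)=l(x)+l(x^{-1}y)$). For $\lambda\vDash n$ let $J(\lambda)=S\setminus\{s_{\lambda_1},s_{\lambda_1+\lambda_2},\ldots,s_{\lambda_1+\cdots+\lambda_{r-1}}\}$, let $W_{J(\lambda)}=\langle J(\lambda)\rangle$, let $w_{J(\lambda)}$ be its longest element, and let $\mathfrak{X}_{J(\lambda)}$ be the set of minimum length representatives of the right cosets $W_{J(\lambda)}w$. $\sim_R$ is the Kazhdan-Lusztig right cell equivalence on $S_n$; explicitly, $w\sim_R w'$ if and only if the Robinson-Schensted recording tableaux agree, $\mathcal Q(w)=\mathcal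 Q(w')$, where $w$ is inserted via its row-form $[1w,\ldots,nw]$. $Z(\lambda)=\{e\in\mathfrak{X}_{J(\lambda)} : w_{J(\lambda)}e\sim_R w_{J(\lambda)}\}$ and $Y(\lambda)=\{x\in Z(\lambda) : x\text{ is not a prefix of any other }y\in Z(\lambda)\}$. A diagram $D$ is a non-empty finite subset of $\mathbb Z^2$ whose nodes $(a,b)$ have row index $a$ and column index $b$ (rows top to bottom, columns left to right), with no empty rows or columns, and both rows and columns indexed consecutively from $1$. Its row-composition $\lambda_D$ lists the numbers of nodes on its successive rows; $\mathcal D^{(\lambda)}$ is the set of diagrams $D$ with $\lambda_D=\lambda$. For a diagram $D$ of size $n$, $t^D$ and $t_D$ are the bijections $D\to\{1,\ldots,n\}$ filling the nodes of $D$ with $1,\ldots,n$ by rows and by columns respectively, and $w_D\in S_n$ is defined by $t^Dw_D=t_D$, where $tw$ is obtained from $t$ by replacing each entry $i$ by $iw$. For $d\in\mathfrak{X}_{J(\lambda)}$, $D(d,\lambda)$ is the unique diagram with the minimum number of columns among all $E\in\mathcal D^{(\lambda)}$ with $w_E=d$ (such diagrams exist, and the minimal one is known to be unique). $\mathcal E^{(\lambda)}=\{D(y,\lambda) : y\in Y(\lambda)\}$; the map $y\mapsto D(y,\lambda)$ is a bijection $Y(\lambda)\to\mathcal E^{(\lambda)}$ with inverse $D\mapsto w_D$. A path of length $m$ in $D$ is a non-empty sequence of nodes $((a_i,b_i))_{i=1}^m$ of $D$ with $a_i<a_{i+1}$ and $b_i\le b_{i+1}$. A $k$-path is a sequence of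 $k$ mutually disjoint paths; its length is the sum of the lengths of its paths. $D$ has subsequence type $\nu=(\nu_1,\ldots,\nu_p)\vdash n$ if the maximum length of a $k$-path in $D$ is $\nu_1+\cdots+\nu_k$ for $1\le k\le p$. $D$ is admissible if it is of subsequence type $\lambda_D'$. It is known that $w_{J(\lambda_D)}w_D\sim_R w_{J(\lambda_D)}$ if and only if $D$ is admissible. The map $\psi$ from admissible diagrams in $\mathcal D^{(\lambda)}$ to admissible diagrams in $\mathcal D^{(\lambda_* )}$: given an admissible $D\in\mathcal D^{(\lambda)}$, consider all diagrams constructed from $D$ by appending an $(r+1)$-th row with a single node; $D\psi$ is the one among these which is admissible and such that the column index of the new node is minimal. It is known from earlier work that $\psi$ is well defined and that, for every composition $\lambda$, it induces a well-defined injective map $\theta_*\colon Y(\lambda)\to Y(\lambda_* )$, $w_D\mapsto w_{D\psi}$ ($D\in\mathcal E^{(\lambda)}$). *)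

theory Defs
  imports "HOL-Algebra.Sym_Groups"
begin

section \<open>Compositions\<close>

definition composition :: "nat list \<Rightarrow> nat \<Rightarrow> bool" where
  "composition lam n \<longleftrightarrow> (\<forall>x \<in> set lam. 0 < x) \<and> sum_list lam = n"

definition is_partition :: "nat list \<Rightarrow> nat \<Rightarrow> bool" where
  "is_partition nu n \<longleftrightarrow> composition nu n \<and> sorted_wrt (\<ge>) nu"

text \<open>Only meaningful for nonempty compositions. List positions count from 0, parts from 1.\<close>

definition conjugate :: "nat list \<Rightarrow> nat list" where
  "conjugate lam = map (\<lambda>i. card {j. j < length lam \<and> i \<le> lam ! j}) [1..<Suc (Max (set lam))]"


section \<open>The symmetric group as a Coxeter group\<close>

text \<open>
  Elements of the symmetric group are functions permuting \<open>{1..n}\<close>. They act on the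
  right, so that products are composed from left to right, opposite to the multiplication
  of \<^const>\<open>sym_group\<close>; for the subgroup generated by a set this makes no difference.
\<close>

definition rmult :: "(nat \<Rightarrow> nat) \<Rightarrow> (nat \<Rightarrow> nat) \<Rightarrow> (nat \<Rightarrow> nat)" (infixl "\<cdot>" 70) where
  "x \<cdot> y = y \<circ> x"

definition cox_gen :: "nat \<Rightarrow> (nat \<Rightarrow> nat)" where
  "cox_gen i = transpose i (Suc i)"

text \<open>Words in the Coxeter generators are given by the list of their indices.\<close>

definition word_prod :: "nat list \<Rightarrow> (nat \<Rightarrow> nat)" where
  "word_prod us = foldr (\<lambda>i w. cox_gen i \<cdot> w) us id"

definition cox_length :: "nat \<Rightarrow> (nat \<Rightarrow> nat) \<Rightarrow> nat" where
  "cox_length n w = (LEAST k. \<exists>us. set us \<subseteq> {1..<n} \<and> word_prod us = w \<and> length us = k)"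

definition reduced_expr :: "nat \<Rightarrow> nat list \<Rightarrow> (nat \<Rightarrow> nat) \<Rightarrow> bool" where
  "reduced_expr n us w \<longleftrightarrow>
     set us \<subseteq> {1..<n} \<and> word_prod us = w \<and> length us = cox_length n w"

definition is_prefix :: "nat \<Rightarrow> (nat \<Rightarrow> nat) \<Rightarrow> (nat \<Rightarrow> nat) \<Rightarrow> bool" where
  "is_prefix n x y \<longleftrightarrow> (\<exists>us vs. reduced_expr n us x \<and> reduced_expr n (us @ vs) y)"

definition J_set :: "nat list \<Rightarrow> (nat \<Rightarrow> nat) set" where
  "J_set lam = cox_gen ` {1..<sum_list lam}
     - {cox_gen (sum_list (take i lam)) | i. 1 \<le> i \<and> i < length lam}"

definition W_J :: "nat list \<Rightarrow> (nat \<Rightarrow> nat) set" where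
  "W_J lam = generate (sym_group (sum_list lam)) (J_set lam)"

definition longest_W_J :: "nat list \<Rightarrow> (nat \<Rightarrow> nat)" where
  "longest_W_J lam =
     (THE w. w \<in> W_J lam \<and> (\<forall>u \<in> W_J lam. cox_length (sum_list lam) u \<le> cox_length (sum_list lam) w))"

definition min_coset_reps :: "nat list \<Rightarrow> (nat \<Rightarrow> nat) set" where
  "min_coset_reps lam =
     {d. d permutes {1..sum_list lam} \<and>
         (\<forall>u \<in> W_J lam. cox_length (sum_list lam) d \<le> cox_length (sum_list lam) (u \<cdot> d))}"


section \<open>Robinson--Schensted and right cells\<close>

text \<open>Insertion into a row returns the new row and the entry bumped out of it, if any.\<close>

fun row_insert :: "nat \<Rightarrow> nat list \<Rightarrow> nat list \<times> nat option" where
  "row_insert x [] = ([x], None)"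
| "row_insert x (y # ys) =
     (if x < y then (x # ys, Some y)
      else (case row_insert x ys of (zs, b) \<Rightarrow> (y # zs, b)))"

text \<open>
  Insertion into a tableau (a list of rows, top row first) returns the new tableau and the
  index, counted from 0, of the row in which it has grown.
\<close>

fun tab_insert :: "nat \<Rightarrow> nat list list \<Rightarrow> nat list list \<times> nat" where
  "tab_insert x [] = ([[x]], 0)"
| "tab_insert x (r # rs) =
     (case row_insert x r of
        (r', None) \<Rightarrow> (r' # rs, 0)
      | (r', Some y) \<Rightarrow> (case tab_insert y rs of (rs', k) \<Rightarrow> (r' # rs', Suc k)))"

definition append_to_row :: "nat \<Rightarrow> nat \<Rightarrow> nat list list \<Rightarrow> nat list list" where
  "append_to_row i k Q = (if k < length Q then Q[k := Q ! k @ [i]] else Q @ [[i]])"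

fun rs_step :: "nat \<times> nat \<Rightarrow> nat list list \<times> nat list list \<Rightarrow> nat list list \<times> nat list list" where
  "rs_step (i, x) (P, Q) = (case tab_insert x P of (P', k) \<Rightarrow> (P', append_to_row i k Q))"

text \<open>The recording tableau of \<open>w\<close>, whose row-form is \<open>[w 1, \<dots>, w n]\<close>.\<close>

definition recording_tableau :: "nat \<Rightarrow> (nat \<Rightarrow> nat) \<Rightarrow> nat list list" where
  "recording_tableau n w = snd (fold rs_step (map (\<lambda>i. (i, w i)) [1..<Suc n]) ([], []))"

text \<open>The Kazhdan--Lusztig right cell equivalence, in its explicit Robinson--Schensted form.\<close>

definition right_cell_equiv :: "nat \<Rightarrow> (nat \<Rightarrow> nat) \<Rightarrow> (nat \<Rightarrow> nat) \<Rightarrow> bool" where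
  "right_cell_equiv n w w' \<longleftrightarrow> recording_tableau n w = recording_tableau n w'"

definition Z_set :: "nat list \<Rightarrow> (nat \<Rightarrow> nat) set" where
  "Z_set lam = {e \<in> min_coset_reps lam.
     right_cell_equiv (sum_list lam) (longest_W_J lam \<cdot> e) (longest_W_J lam)}"

definition Y_set :: "nat list \<Rightarrow> (nat \<Rightarrow> nat) set" where
  "Y_set lam = {x \<in> Z_set lam. \<not> (\<exists>y \<in> Z_set lam. y \<noteq> x \<and> is_prefix (sum_list lam) x y)}"


section \<open>Diagrams\<close>

text \<open>
  A node is a pair of row index and column index. Since both are numbered consecutively
  from 1, natural number coordinates suffice.
\<close>

type_synonym diag = "(nat \<times> nat) set"

definition num_rows :: "diag \<Rightarrow> nat" where
  "num_rows D = card (fst ` D)"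

definition num_cols :: "diag \<Rightarrow> nat" where
  "num_cols D = card (snd ` D)"

definition diagram :: "diag \<Rightarrow> bool" where
  "diagram D \<longleftrightarrow> finite D \<and> D \<noteq> {} \<and> fst ` D = {1..num_rows D} \<and> snd ` D = {1..num_cols D}"

definition row_comp :: "diag \<Rightarrow> nat list" where
  "row_comp D = map (\<lambda>a. card {b. (a, b) \<in> D}) [1..<Suc (num_rows D)]"

definition diagrams_of :: "nat list \<Rightarrow> diag set" where
  "diagrams_of lam = {D. diagram D \<and> row_comp D = lam}"

text \<open>The fillings by rows and by columns: the entry at a node is its rank in the reading order.\<close>

definition row_filling :: "diag \<Rightarrow> nat \<times> nat \<Rightarrow> nat" where
  "row_filling D = (\<lambda>(a, b). card {(a', b') \<in> D. a' < a \<or> (a' = a \<and> b' \<le> b)})"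

definition col_filling :: "diag \<Rightarrow> nat \<times> nat \<Rightarrow> nat" where
  "col_filling D = (\<lambda>(a, b). card {(a', b') \<in> D. b' < b \<or> (b' = b \<and> a' \<le> a)})"

text \<open>The permutation taking, at each node, the row entry to the column entry.\<close>

definition diag_perm :: "diag \<Rightarrow> (nat \<Rightarrow> nat)" where
  "diag_perm D =
     (\<lambda>i. if i \<in> {1..card D} then col_filling D (inv_into D (row_filling D) i) else i)"

definition min_diagram :: "(nat \<Rightarrow> nat) \<Rightarrow> nat list \<Rightarrow> diag" where
  "min_diagram d lam = (THE D. is_arg_min num_cols (\<lambda>E. E \<in> diagrams_of lam \<and> diag_perm E = d) D)"

definition E_set :: "nat list \<Rightarrow> diag set" where
  "E_set lam = (\<lambda>y. min_diagram y lam) ` Y_set lam"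


section \<open>Paths and admissible diagrams\<close>

definition is_path :: "diag \<Rightarrow> (nat \<times> nat) list \<Rightarrow> bool" where
  "is_path D p \<longleftrightarrow> p \<noteq> [] \<and> set p \<subseteq> D \<and> successively (\<lambda>(a, b) (a', b'). a < a' \<and> b \<le> b') p"

definition is_k_path :: "diag \<Rightarrow> nat \<Rightarrow> (nat \<times> nat) list list \<Rightarrow> bool" where
  "is_k_path D k ps \<longleftrightarrow> length ps = k \<and> (\<forall>p \<in> set ps. is_path D p) \<and>
     (\<forall>i < k. \<forall>j < k. i \<noteq> j \<longrightarrow> set (ps ! i) \<inter> set (ps ! j) = {})"

definition k_path_lengths :: "diag \<Rightarrow> nat \<Rightarrow> nat set" where
  "k_path_lengths D k = {sum_list (map length ps) | ps. is_k_path D k ps}"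

definition has_subseq_type :: "diag \<Rightarrow> nat list \<Rightarrow> bool" where
  "has_subseq_type D nu \<longleftrightarrow> is_partition nu (card D) \<and>
     (\<forall>k \<in> {1..length nu}. sum_list (take k nu) \<in> k_path_lengths D k \<and>
        (\<forall>m \<in> k_path_lengths D k. m \<le> sum_list (take k nu)))"

definition admissible :: "diag \<Rightarrow> bool" where
  "admissible D \<longleftrightarrow> diagram D \<and> has_subseq_type D (conjugate (row_comp D))"


section \<open>The maps on diagrams and on permutations\<close>

definition append_node :: "diag \<Rightarrow> nat \<Rightarrow> diag" where
  "append_node D b = insert (Suc (num_rows D), b) D"

definition psi :: "diag \<Rightarrow> diag" where
  "psi D = append_node D (LEAST b. admissible (append_node D b))"

text \<open>
  The map \<open>w\<^sub>D \<mapsto> w\<^sub>D\<^sub>\<psi>\<close> for \<open>D\<close> in \<^term>\<open>E_set lam\<close>; there \<^const>\<open>diag_perm\<close> is injective.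
\<close>

definition theta_star :: "nat list \<Rightarrow> (nat \<Rightarrow> nat) \<Rightarrow> (nat \<Rightarrow> nat)" where
  "theta_star lam w = diag_perm (psi (inv_into (E_set lam) diag_perm w))"

end

theory Submission
  imports Defs
begin

text \<open>
  The idea is that, when the last part of \<open>lam\<close> is 1, the map in question does not depend on
  diagrams at all: it sends \<open>d\<close> to the permutation \<open>append_next n d\<close>, whose row-form arises from
  that of \<open>d\<close> by appending the value \<open>d n + 1\<close> and moving up the values that are at least as
  large. That this map is a bijection is then a statement about inversions.

  For permutations \<open>x\<close> and \<open>y\<close>, being a prefix means that the inversions of \<open>x\<close>, as pairs of
  positions, are inversions of \<open>y\<close> (\<open>is_prefix_iff_inversions_subset\<close>). The elements of
  \<open>W_J lam\<close> are the permutations that preserve the blocks of positions given by \<open>lam\<close>, the longest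
  one reverses each block, and the minimal coset representatives increase along each block.

  Every permutation of \<open>{1..n + 1}\<close> is \<open>append_value n d t\<close> for a permutation \<open>d\<close> of \<open>{1..n}\<close>
  and a last value \<open>t\<close>. A recording tableau determines in which row each insertion step ends. For
  the longest element, the steps at the singleton blocks at the end append_value the first row. Hence, if
  \<open>d\<close> is in \<open>Z_set lam\<close>, then \<open>d n\<close> ends the first row of the insertion tableau, and
  \<open>append_value n d t\<close> is in \<open>Z_set (lam @ [1])\<close> if and only if \<open>d \<in> Z_set lam\<close> and
  \<open>d n < t\<close> (\<open>append_value_in_Z_set_iff\<close>). The inversions of \<open>append_value n d t\<close> are those of
  \<open>d\<close> and the pairs \<open>(i, n + 1)\<close> with \<open>t \<le> d i\<close>. The smallest choice \<open>t = d n + 1\<close> thus gives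
  the most inversions, and with it these pairs correspond to the inversions \<open>(i, n)\<close> of \<open>d\<close>.
  So \<open>append_next n\<close> embeds the ordered set \<open>Z_set lam\<close> into \<open>Z_set (lam @ [1])\<close>, with a
  cofinal image, and restricts to a bijection between the sets of maximal elements
  (\<open>bij_betw_append_next\<close>).

  It remains to see that \<open>theta_star lam\<close> is this map. Diagrams with given row-composition and
  permutation are described by the columns of their nodes (\<open>diagram_is_drawing\<close>); in particular
  the one with fewest columns is unique. A diagram whose permutation is in \<open>Z_set lam\<close> is
  admissible: this needs one half of Greene's theorem (\<open>greene_lower_bound\<close>), that is, the
  existence of \<open>k\<close> disjoint increasing subsequences filling the first \<open>k\<close> rows of the
  tableau, which is obtained by following Knuth moves with a colouring of the letters. If \<open>c\<close> is
  the column of the only node in the last row of \<open>D\<close>, then appending a node in column \<open>c\<close>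
  gives a diagram of \<open>append_next n (diag_perm D)\<close>, hence an admissible one; and no smaller column
  will do, because an admissible diagram has a path through all its rows. Therefore \<open>psi\<close>
  chooses the column \<open>c\<close>.
\<close>

section \<open>Inversions, length and prefixes\<close>

text \<open>The inversions of \<open>w\<close> on \<open>{1..n}\<close>, as pairs of positions.\<close>

definition inversions :: "nat \<Rightarrow> (nat \<Rightarrow> nat) \<Rightarrow> (nat \<times> nat) set" where
  "inversions n w = {(i, j). 1 \<le> i \<and> i < j \<and> j \<le> n \<and> w j < w i}"

lemma inversions_iff: "(i, j) \<in> inversions n w \<longleftrightarrow> 1 \<le> i \<and> i < j \<and> j \<le> n \<and> w j < w i"
  by (simp add: inversions_def)

lemma finite_inversions [simp]: "finite (inversions n w)"
  by (rule finite_subset[of _ "{1..n} \<times> {1..n}"]) (auto simp: inversions_def)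

lemma inversions_id [simp]: "inversions n id = {}"
  by (auto simp: inversions_def)

lemma word_prod_snoc: "word_prod (us @ [i]) = cox_gen i \<circ> word_prod us"
  by (induction us) (auto simp: word_prod_def rmult_def fun_eq_iff)

lemma word_prod_append: "word_prod (us @ vs) = word_prod vs \<circ> word_prod us"
proof (induction vs rule: rev_induct)
  case Nil
  show ?case by (simp add: word_prod_def)
next
  case (snoc i vs)
  then show ?case by (metis append.assoc comp_assoc word_prod_snoc)
qed

lemma cox_gen_permutes: "1 \<le> i \<Longrightarrow> i < n \<Longrightarrow> cox_gen i permutes {1..n}"
  unfolding cox_gen_def by (rule permutes_swap_id) auto

lemma word_prod_permutes: "set us \<subseteq> {1..<n} \<Longrightarrow> word_prod us permutes {1..n}"
proof (induction us rule: rev_induct)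
  case Nil
  show ?case by (simp add: word_prod_def permutes_id flip: id_def)
next
  case (snoc i us)
  then show ?case
    unfolding word_prod_snoc by (intro permutes_compose cox_gen_permutes) auto
qed

text \<open>
  Multiplying by a generator on the right exchanges two consecutive values, and affects
  only the pair of their positions.
\<close>

lemma inversions_cox_gen:
  assumes w: "w permutes {1..n}" and pq: "p \<in> {1..n}" "q \<in> {1..n}" "w p = i" "w q = Suc i"
    and "p < q"
  shows "inversions n (cox_gen i \<circ> w) = insert (p, q) (inversions n w)"
    and "(p, q) \<notin> inversions n w"
proof -
  have inj: "w a = w b \<longleftrightarrow> a = b" for a b
    using permutes_inj[OF w] by (simp add: inj_eq)
  show "(p, q) \<notin> inversions n w" using pq by (simp add: inversions_def)
  have *: "cox_gen i (w b) < cox_gen i (w a) \<longleftrightarrow> w b < w a \<or> (a = p \<and> b = q)"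
    if "a < b" for a b
  proof -
    have "a \<noteq> q \<or> b \<noteq> p" using that \<open>p < q\<close> by auto
    moreover have "w a = i \<longleftrightarrow> a = p" "w b = i \<longleftrightarrow> b = p"
      "w a = Suc i \<longleftrightarrow> a = q" "w b = Suc i \<longleftrightarrow> b = q"
      using inj pq by metis+
    ultimately show ?thesis
      using that \<open>p < q\<close> by (auto simp: cox_gen_def transpose_def)
  qed
  have "(a, b) \<in> inversions n (cox_gen i \<circ> w) \<longleftrightarrow> (a, b) \<in> insert (p, q) (inversions n w)" for a b
    using * pq \<open>p < q\<close> by (auto simp: inversions_def)
  then show "inversions n (cox_gen i \<circ> w) = insert (p, q) (inversions n w)"
    by (auto simp: set_eq_iff)
qed

lemma inversions_cox_gen_cases:
  assumes w: "w permutes {1..n}" and i: "1 \<le> i" "i < n"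
  obtains (up) p q where "p < q" "p \<in> {1..n}" "q \<in> {1..n}" "w p = i" "w q = Suc i"
      "inversions n (cox_gen i \<circ> w) = insert (p, q) (inversions n w)" "(p, q) \<notin> inversions n w"
  | (down) p q where "inversions n w = insert (p, q) (inversions n (cox_gen i \<circ> w))"
      "(p, q) \<notin> inversions n (cox_gen i \<circ> w)"
proof -
  have "i \<in> w ` {1..n}" "Suc i \<in> w ` {1..n}"
    unfolding permutes_image[OF w] using i by auto
  then obtain p q where pq: "p \<in> {1..n}" "q \<in> {1..n}" "w p = i" "w q = Suc i"
    by (elim imageE) metis
  from pq have "p \<noteq> q" by auto
  then consider "p < q" | "q < p" by (rule linorder_neqE_nat)
  then show thesis
  proof cases
    case 1
    then show thesis using inversions_cox_gen[OF w pq] pq by (intro up[of p q]) simp_all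
  next
    case 2
    let ?w = "cox_gen i \<circ> w"
    have w': "?w permutes {1..n}"
      using w i by (intro permutes_compose cox_gen_permutes)
    have swapped: "?w q = i" "?w p = Suc i" using pq by (auto simp: cox_gen_def)
    have cancel: "cox_gen i \<circ> ?w = w"
      by (auto simp: cox_gen_def fun_eq_iff)
    show thesis
      using inversions_cox_gen[OF w' pq(2,1) swapped 2] unfolding cancel by (rule down)
  qed
qed

lemma card_inversions_cox_gen_le:
  assumes "w permutes {1..n}" "1 \<le> i" "i < n"
  shows "card (inversions n (cox_gen i \<circ> w)) \<le> Suc (card (inversions n w))"
  using assms
proof (cases rule: inversions_cox_gen_cases)
  case (up p q)
  then show ?thesis by simp
next
  case (down p q)
  then have "card (inversions n w) = Suc (card (inversions n (cox_gen i \<circ> w)))"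
    by (metis card_insert_disjoint finite_inversions)
  then show ?thesis by simp
qed

lemma card_inversions_append_le:
  assumes "set us \<subseteq> {1..<n}" "set vs \<subseteq> {1..<n}"
  shows "card (inversions n (word_prod (us @ vs))) \<le> card (inversions n (word_prod us)) + length vs"
  using assms(2)
proof (induction vs rule: rev_induct)
  case Nil
  then show ?case by simp
next
  case (snoc i vs)
  have "word_prod (us @ vs) permutes {1..n}"
    using assms(1) snoc.prems by (intro word_prod_permutes) auto
  then have "card (inversions n (cox_gen i \<circ> word_prod (us @ vs)))
      \<le> Suc (card (inversions n (word_prod (us @ vs))))"
    using snoc.prems by (intro card_inversions_cox_gen_le) auto
  moreover have "word_prod (us @ vs @ [i]) = cox_gen i \<circ> word_prod (us @ vs)"
    using word_prod_snoc[of "us @ vs" i] by simp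
  moreover have "card (inversions n (word_prod (us @ vs)))
      \<le> card (inversions n (word_prod us)) + length vs"
    using snoc by simp
  ultimately show ?case unfolding length_append by (simp only: list.size)
qed

lemma card_inversions_word_prod_le:
  "set us \<subseteq> {1..<n} \<Longrightarrow> card (inversions n (word_prod us)) \<le> length us"
  using card_inversions_append_le[of "[]" n us] by (simp add: word_prod_def)

lemma strict_mono_on_interval_ge:
  fixes f :: "nat \<Rightarrow> nat"
  assumes "\<And>i. 1 \<le> i \<Longrightarrow> i < n \<Longrightarrow> f i < f (Suc i)" "1 \<le> f 1 \<or> n = 0"
  shows "1 \<le> i \<Longrightarrow> i \<le> n \<Longrightarrow> i \<le> f i"
proof (induction i)
  case (Suc i)
  show ?case
  proof (cases "i = 0")
    case False
    then show ?thesis using Suc assms(1)[of i] by force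
  qed (use Suc assms in auto)
qed simp

lemma strict_mono_permutes_id:
  fixes f :: "nat \<Rightarrow> nat"
  assumes p: "f permutes {1..n}" and mono: "\<And>i. 1 \<le> i \<Longrightarrow> i < n \<Longrightarrow> f i < f (Suc i)"
  shows "f = id"
proof -
  have in_range: "f i \<in> {1..n}" if "i \<in> {1..n}" for i
    using permutes_in_image[OF p] that by blast
  have ge: "i \<le> f i" if "i \<in> {1..n}" for i
    using strict_mono_on_interval_ge[of n f i] mono in_range[of 1] that by fastforce
  have le: "f i \<le> i" if "i \<in> {1..n}" for i
  proof -
    have "f i + (n - i) \<le> f (i + k) + (n - (i + k))" if "i + k \<le> n" for k
      using that
    proof (induction k)
      case (Suc k)
      then show ?case using mono[of "i + k"] \<open>i \<in> {1..n}\<close> by fastforce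
    qed simp
    from this[of "n - i"] show ?thesis
      using that in_range[of n] by fastforce
  qed
  show ?thesis
    using ge le p by (metis antisym eq_id_iff permutes_not_in)
qed

text \<open>
  If the inversions of \<open>x\<close> are among those of \<open>y\<close>, then one gets from \<open>x\<close> to \<open>y\<close> by
  exchanging consecutive values, each step creating one inversion of \<open>y\<close>. If moreover both
  permutations preserve the fibres of a monotone function \<open>B\<close>, then so do the steps.
  The constant function \<open>B\<close> gives the unrestricted statement.
\<close>

lemma inversions_subset_imp_word:
  fixes B :: "nat \<Rightarrow> nat"
  assumes B: "mono B" "\<And>p. p \<in> {1..n} \<Longrightarrow> B (y p) = B p"
    and y: "y permutes {1..n}"
  shows "x permutes {1..n} \<Longrightarrow> inversions n x \<subseteq> inversions n y \<Longrightarrow>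
    (\<And>p. p \<in> {1..n} \<Longrightarrow> B (x p) = B p) \<Longrightarrow>
    \<exists>vs. set vs \<subseteq> {i \<in> {1..<n}. B i = B (Suc i)} \<and> y = word_prod vs \<circ> x \<and>
      card (inversions n y) = card (inversions n x) + length vs"
proof (induction "card (inversions n y - inversions n x)" arbitrary: x rule: less_induct)
  case less
  show ?case
  proof (cases "\<exists>i p q. p < q \<and> p \<in> {1..n} \<and> q \<in> {1..n} \<and> x p = i \<and> x q = Suc i \<and>
      (p, q) \<in> inversions n y")
    case True
    then obtain i p q where *: "p < q" "p \<in> {1..n}" "q \<in> {1..n}" "x p = i" "x q = Suc i"
      "(p, q) \<in> inversions n y"
      by blast
    define x' where "x' = cox_gen i \<circ> x"
    have i: "i \<in> {1..<n}"
      using * permutes_in_image[OF less.prems(1), of p] permutes_in_image[OF less.prems(1), of q]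
      by auto
    have inv: "inversions n x' = insert (p, q) (inversions n x)" "(p, q) \<notin> inversions n x"
      using inversions_cox_gen[OF less.prems(1) *(2-5,1)] unfolding x'_def by auto
    have "B (y q) \<le> B (y p)" using * B(1) by (simp add: inversions_def monoD)
    then have "B q \<le> B p" using * B(2) by simp
    moreover have "B p \<le> B q" using * B(1) by (simp add: monoD)
    ultimately have "B p = B q" by simp
    then have Bi: "B i = B (Suc i)"
      using * less.prems(3) by metis
    have x'_perm: "x' permutes {1..n}"
      unfolding x'_def using less.prems(1) i by (intro permutes_compose cox_gen_permutes) auto
    have x'_B: "B (x' t) = B t" if "t \<in> {1..n}" for t
      using less.prems(3)[OF that] Bi by (auto simp: x'_def cox_gen_def transpose_def)
    have sub: "inversions n x' \<subseteq> inversions n y"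
      using inv * less.prems by auto
    have "inversions n y - inversions n x' \<subset> inversions n y - inversions n x"
      using inv * by auto
    then have "card (inversions n y - inversions n x') < card (inversions n y - inversions n x)"
      by (intro psubset_card_mono) auto
    from less.hyps[OF this x'_perm sub x'_B] obtain vs where
      vs: "set vs \<subseteq> {i \<in> {1..<n}. B i = B (Suc i)}" "y = word_prod vs \<circ> x'"
        "card (inversions n y) = card (inversions n x') + length vs"
      by blast
    have "word_prod (i # vs) \<circ> x = y"
      using vs word_prod_append[of "[i]" vs] by (simp add: x'_def comp_assoc word_prod_def rmult_def)
    moreover have "card (inversions n y) = card (inversions n x) + length (i # vs)"
      using vs inv by simp
    ultimately show ?thesis
      using vs i Bi by (intro exI[of _ "i # vs"]) auto
  next
    case False
    \<comment> \<open>Then \<open>y\<close> composed with the inverse of \<open>x\<close> is increasing, hence the identity.\<close>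
    define z where "z = y \<circ> inv_into UNIV x"
    have z: "z permutes {1..n}"
      unfolding z_def using y less.prems(1) by (intro permutes_compose permutes_inv)
    have "z i < z (Suc i)" if i: "1 \<le> i" "i < n" for i
    proof -
      let ?p = "inv_into UNIV x i" and ?q = "inv_into UNIV x (Suc i)"
      have pq: "?p \<in> {1..n}" "?q \<in> {1..n}" "x ?p = i" "x ?q = Suc i"
        using permutes_in_image[OF permutes_inv[OF less.prems(1)]] i
          permutes_inverses[OF less.prems(1)] by auto
      have inj: "y ?p \<noteq> y ?q" using pq permutes_inj[OF y] by (metis injD n_not_Suc_n)
      consider "?p < ?q" | "?q < ?p" using pq by (metis n_not_Suc_n nat_neq_iff)
      then have "y ?p < y ?q"
      proof cases
        case 1
        then have "(?p, ?q) \<notin> inversions n y" using pq False by blast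
        then show ?thesis using 1 pq inj by (auto simp: inversions_def)
      next
        case 2
        then have "(?q, ?p) \<in> inversions n x" using pq by (auto simp: inversions_def)
        then show ?thesis using less.prems(2) by (auto simp: inversions_def)
      qed
      then show ?thesis by (simp add: z_def)
    qed
    then have "z = id" using strict_mono_permutes_id[OF z] by blast
    then have "y = x"
      using permutes_inverses[OF less.prems(1)] by (metis comp_apply ext id_apply z_def)
    then show ?thesis by (intro exI[of _ "[]"]) (auto simp: word_prod_def)
  qed
qed

lemma reduced_word_exists:
  assumes "w permutes {1..n}"
  shows "\<exists>us. set us \<subseteq> {1..<n} \<and> word_prod us = w \<and> length us = card (inversions n w)"
proof -
  obtain us where "set us \<subseteq> {i \<in> {1..<n}. True}" "w = word_prod us \<circ> id"
    "card (inversions n w) = card (inversions n id) + length us"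
    using inversions_subset_imp_word[of "\<lambda>_. 0" n w id] assms permutes_id[of "{1..n}"]
    by (simp add: mono_def) blast
  then show ?thesis by (intro exI[of _ us]) auto
qed

lemma cox_length_eq_card_inversions:
  assumes "w permutes {1..n}"
  shows "cox_length n w = card (inversions n w)"
proof -
  obtain us where "set us \<subseteq> {1..<n}" "word_prod us = w" "length us = card (inversions n w)"
    using reduced_word_exists[OF assms] by blast
  then show ?thesis unfolding cox_length_def
    by (intro Least_equality) (metis card_inversions_word_prod_le)+
qed

lemma reduced_append_inversions_subset:
  assumes "set us \<subseteq> {1..<n}"
  shows "set vs \<subseteq> {1..<n} \<Longrightarrow>
    card (inversions n (word_prod (us @ vs))) = card (inversions n (word_prod us)) + length vs \<Longrightarrow>
    inversions n (word_prod us) \<subseteq> inversions n (word_prod (us @ vs))"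
proof (induction vs rule: rev_induct)
  case Nil
  then show ?case by simp
next
  case (snoc i vs)
  define w where "w = word_prod (us @ vs)"
  have i: "1 \<le> i" "i < n" and vs: "set vs \<subseteq> {1..<n}" using snoc.prems by auto
  have w: "w permutes {1..n}"
    unfolding w_def using assms vs by (intro word_prod_permutes) auto
  have w': "word_prod (us @ vs @ [i]) = cox_gen i \<circ> w"
    using word_prod_snoc[of "us @ vs" i] by (simp add: w_def)
  have "card (inversions n w) \<le> card (inversions n (word_prod us)) + length vs"
    unfolding w_def using assms vs by (rule card_inversions_append_le)
  moreover have "card (inversions n (cox_gen i \<circ> w)) = card (inversions n (word_prod us)) + Suc (length vs)"
    using snoc.prems(2) unfolding w' length_append by (simp only: list.size)
  moreover have "card (inversions n (cox_gen i \<circ> w)) \<le> Suc (card (inversions n w))"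
    using w i by (rule card_inversions_cox_gen_le)
  ultimately have eq: "card (inversions n w) = card (inversions n (word_prod us)) + length vs"
    and gt: "card (inversions n (cox_gen i \<circ> w)) > card (inversions n w)"
    by auto
  have "inversions n (word_prod us) \<subseteq> inversions n w"
    using snoc.IH vs eq by (simp add: w_def)
  moreover from w i have "inversions n w \<subseteq> inversions n (cox_gen i \<circ> w)"
  proof (cases rule: inversions_cox_gen_cases)
    case (up p q)
    then show ?thesis by auto
  next
    case (down p q)
    then have "card (inversions n w) = Suc (card (inversions n (cox_gen i \<circ> w)))"
      by (metis card_insert_disjoint finite_inversions)
    then show ?thesis using gt by simp
  qed
  ultimately show ?case by (simp only: w')
qed

lemma is_prefix_iff_inversions_subset:
  assumes x: "x permutes {1..n}" and y: "y permutes {1..n}"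
  shows "is_prefix n x y \<longleftrightarrow> inversions n x \<subseteq> inversions n y"
proof
  assume "is_prefix n x y"
  then obtain us vs where *: "reduced_expr n us x" "reduced_expr n (us @ vs) y"
    by (auto simp: is_prefix_def)
  then have "inversions n (word_prod us) \<subseteq> inversions n (word_prod (us @ vs))"
    using x y by (intro reduced_append_inversions_subset)
      (auto simp: reduced_expr_def cox_length_eq_card_inversions)
  then show "inversions n x \<subseteq> inversions n y"
    using * by (simp add: reduced_expr_def)
next
  assume sub: "inversions n x \<subseteq> inversions n y"
  obtain us where us: "set us \<subseteq> {1..<n}" "word_prod us = x" "length us = card (inversions n x)"
    using reduced_word_exists[OF x] by blast
  obtain vs where vs: "set vs \<subseteq> {i \<in> {1..<n}. True}" "y = word_prod vs \<circ> x"
    "card (inversions n y) = card (inversions n x) + length vs"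
    using inversions_subset_imp_word[of "\<lambda>_. 0" n y x] x y sub by (simp add: mono_def) blast
  have "reduced_expr n us x" "reduced_expr n (us @ vs) y"
    using us vs x y by (auto simp: reduced_expr_def cox_length_eq_card_inversions word_prod_append)
  then show "is_prefix n x y" by (auto simp: is_prefix_def)
qed

lemma inversions_inject:
  assumes "x permutes {1..n}" "y permutes {1..n}" "inversions n x = inversions n y"
  shows "x = y"
proof -
  have "\<exists>vs. y = word_prod vs \<circ> x \<and> card (inversions n y) = card (inversions n x) + length vs"
    using inversions_subset_imp_word[of "\<lambda>_. 0" n y x] assms by (auto simp: mono_def)
  then show ?thesis using assms(3) by (auto simp: word_prod_def)
qed

text \<open>
  Multiplying by a generator on the left exchanges the values at two consecutive positions. At a
  descent this removes inversions.
\<close>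

lemma card_inversions_descent:
  assumes d: "d permutes {1..n}" and i: "1 \<le> i" "i < n" "d (Suc i) < d i"
  shows "card (inversions n (d \<circ> cox_gen i)) < card (inversions n d)"
proof -
  let ?f = "map_prod (cox_gen i) (cox_gen i)"
  have "?f ` inversions n (d \<circ> cox_gen i) \<subseteq> inversions n d - {(i, Suc i)}"
    using i by (fastforce simp: inversions_def cox_gen_def transpose_def split: if_splits)
  moreover have "inj ?f"
    by (intro prod.inj_map) (auto simp: cox_gen_def)
  then have "inj_on ?f (inversions n (d \<circ> cox_gen i))"
    by (rule inj_on_subset) simp
  ultimately have "card (inversions n (d \<circ> cox_gen i)) \<le> card (inversions n d - {(i, Suc i)})"
    by (intro card_inj_on_le[of ?f]) auto
  also have "\<dots> < card (inversions n d)"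
    using i by (intro card_Diff1_less) (auto simp: inversions_iff)
  finally show ?thesis .
qed

section \<open>Blocks and parabolic subgroups\<close>

text \<open>
  The index, counted from 1, of the block that contains the position \<open>i\<close>, when the positions are
  divided into consecutive blocks of the lengths in the list. Positions behind the last block get
  an index one larger than that of the last block, which makes the function monotone.
\<close>

fun blk :: "nat list \<Rightarrow> nat \<Rightarrow> nat" where
  "blk [] i = 1"
| "blk (m # ms) i = (if i \<le> m then 1 else Suc (blk ms (i - m)))"

lemma blk_ge_1: "1 \<le> blk lam i"
  by (cases "(lam, i)" rule: blk.cases) auto

lemma blk_mono: "i \<le> j \<Longrightarrow> blk lam i \<le> blk lam j"
  by (induction lam i arbitrary: j rule: blk.induct) (auto simp: blk_ge_1)

lemma mono_blk: "mono (blk lam)"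
  by (simp add: mono_def blk_mono)

lemma blk_le_length: "1 \<le> i \<Longrightarrow> i \<le> sum_list lam \<Longrightarrow> blk lam i \<le> length lam"
  by (induction lam i rule: blk.induct) auto

lemma blk_append: "i \<le> sum_list lam \<Longrightarrow> lam \<noteq> [] \<Longrightarrow> blk (lam @ ms) i = blk lam i"
proof (induction lam i rule: blk.induct)
  case (2 m lam i)
  then show ?case by (cases "lam = []") auto
qed auto

lemma blk_append_right: "sum_list lam < i \<Longrightarrow> blk (lam @ ms) i = length lam + blk ms (i - sum_list lam)"
  by (induction lam i rule: blk.induct) auto

lemma blk_snoc:
  assumes "1 \<le> i" "i \<le> sum_list lam + m"
  shows "blk (lam @ [m]) i = (if i \<le> sum_list lam then blk lam i else Suc (length lam))"
proof (cases "i \<le> sum_list lam")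
  case True
  moreover from True assms have "lam \<noteq> []" by auto
  ultimately show ?thesis by (simp add: blk_append)
next
  case False
  then show ?thesis using assms by (simp add: blk_append_right)
qed

text \<open>The block with index \<open>a + 1\<close> is the interval of positions between two partial sums.\<close>

lemma blk_eq_iff:
  assumes "1 \<le> i" "i \<le> sum_list lam" "a < length lam"
  shows "blk lam i = Suc a \<longleftrightarrow> sum_list (take a lam) < i \<and> i \<le> sum_list (take (Suc a) lam)"
  using assms
proof (induction lam i arbitrary: a rule: blk.induct)
  case (2 m lam i)
  show ?case
  proof (cases a)
    case 0
    then show ?thesis using 2 blk_ge_1[of lam "i - m"] by auto
  next
    case (Suc a')
    then show ?thesis using 2(1)[of a'] 2(2-) by auto
  qed
qed auto

lemma card_blk_eq:
  assumes "a < length lam"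
  shows "card {i \<in> {1..sum_list lam}. blk lam i = Suc a} = lam ! a"
proof -
  have "sum_list (take (Suc a) lam) \<le> sum_list lam"
    by (metis append_take_drop_id le_add1 sum_list_append)
  then have "{i \<in> {1..sum_list lam}. blk lam i = Suc a}
      = {sum_list (take a lam)<..sum_list (take (Suc a) lam)}"
    using blk_eq_iff[OF _ _ assms] by (auto 4 0)
  then show ?thesis
    using assms by (simp add: take_Suc_conv_app_nth)
qed

lemma blk_le_eq:
  assumes "a \<le> length lam"
  shows "{i \<in> {1..sum_list lam}. blk lam i \<le> a} = {1..sum_list (take a lam)}"
  using assms
proof (induction a)
  case 0
  have "blk lam i \<noteq> 0" for i using blk_ge_1[of lam i] by auto
  then show ?case by auto
next
  case (Suc a)
  have le: "sum_list (take (Suc a) lam) \<le> sum_list lam"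
    by (metis append_take_drop_id le_add1 sum_list_append)
  have suc: "sum_list (take (Suc a) lam) = sum_list (take a lam) + lam ! a"
    using Suc.prems by (simp add: take_Suc_conv_app_nth)
  have eq: "{i \<in> {1..sum_list lam}. blk lam i = Suc a}
      = {sum_list (take a lam)<..sum_list (take (Suc a) lam)}"
    using blk_eq_iff[of _ lam a] Suc.prems le by (auto 4 0)
  have "{i \<in> {1..sum_list lam}. blk lam i \<le> Suc a} = 
     {i \<in> {1..sum_list lam}. blk lam i \<le> a} \<union> {i \<in> {1..sum_list lam}. blk lam i = Suc a}"
    by auto
  also have "\<dots> = {1..sum_list (take a lam)} \<union> {sum_list (take a lam)<..sum_list (take (Suc a) lam)}"
    using Suc eq by simp
  also have "\<dots> = {1..sum_list (take (Suc a) lam)}"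
    using suc by auto
  finally show ?case .
qed

lemma blk_jump_iff:
  assumes n: "n = sum_list lam" and i: "1 \<le> i" "i < n"
  shows "blk lam i \<noteq> blk lam (Suc i) \<longleftrightarrow> (\<exists>m. 1 \<le> m \<and> m < length lam \<and> i = sum_list (take m lam))"
proof
  assume ne: "blk lam i \<noteq> blk lam (Suc i)"
  then have lt: "blk lam i < blk lam (Suc i)" using blk_mono[of i "Suc i" lam] by simp
  let ?m = "blk lam i"
  have m: "1 \<le> ?m" "?m < length lam"
    using lt blk_ge_1 blk_le_length[of "Suc i" lam] i n by auto
  have "i \<le> sum_list (take ?m lam)"
    using blk_le_eq[of ?m lam] m i n by auto
  moreover have "\<not> Suc i \<le> sum_list (take ?m lam)"
  proof
    assume "Suc i \<le> sum_list (take ?m lam)"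
    then have "Suc i \<in> {i \<in> {1..sum_list lam}. blk lam i \<le> ?m}"
      using blk_le_eq[of ?m lam] m by simp
    then show False using lt by simp
  qed
  ultimately show "\<exists>m. 1 \<le> m \<and> m < length lam \<and> i = sum_list (take m lam)"
    using m by (intro exI[of _ ?m]) auto
next
  assume "\<exists>m. 1 \<le> m \<and> m < length lam \<and> i = sum_list (take m lam)"
  then obtain m where m: "1 \<le> m" "m < length lam" "i = sum_list (take m lam)" by blast
  have "j \<in> {i \<in> {1..sum_list lam}. blk lam i \<le> m} \<longleftrightarrow> 1 \<le> j \<and> j \<le> sum_list (take m lam)" for j
    using blk_le_eq[of m lam] m by simp
  from this[of i] this[of "Suc i"] have "blk lam i \<le> m" "\<not> blk lam (Suc i) \<le> m"
    using m i n by simp_all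
  then show "blk lam i \<noteq> blk lam (Suc i)" by auto
qed

lemma cox_gen_inject: "cox_gen i = cox_gen j \<Longrightarrow> i = j"
proof -
  assume "cox_gen i = cox_gen j"
  then have "cox_gen i i = cox_gen j i" "cox_gen i (Suc i) = cox_gen j (Suc i)" by simp_all
  then show "i = j" by (auto simp: cox_gen_def transpose_def split: if_splits)
qed

text \<open>
  The set \<^const>\<open>J_set\<close> consists of the generators that exchange positions of the same block.
\<close>

lemma J_set_eq:
  assumes n: "n = sum_list lam"
  shows "J_set lam = cox_gen ` {i \<in> {1..<n}. blk lam i = blk lam (Suc i)}"
proof -
  have "cox_gen i \<in> J_set lam \<longleftrightarrow> blk lam i = blk lam (Suc i)" if "i \<in> {1..<n}" for i
    using blk_jump_iff[OF n, of i] that n cox_gen_inject unfolding J_set_def by auto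
  then show ?thesis unfolding J_set_def n by auto
qed

lemma cox_gen_preserves: "B i = B (Suc i) \<Longrightarrow> B (cox_gen i p) = B p"
  by (auto simp: cox_gen_def transpose_def)

lemma word_prod_in_generate:
  "(\<And>i. i \<in> set vs \<Longrightarrow> cox_gen i \<in> H) \<Longrightarrow> word_prod vs \<in> generate (sym_group n) H"
proof (induction vs)
  case Nil
  have "word_prod [] = one (sym_group n)" by (simp add: word_prod_def sym_group_one)
  then show ?case by (simp only: generate.one)
next
  case (Cons i vs)
  have "mult (sym_group n) (word_prod vs) (cox_gen i) \<in> generate (sym_group n) H"
    using Cons by (intro generate.eng[OF _ generate.incl]) auto
  moreover have "word_prod (i # vs) = word_prod vs \<circ> cox_gen i"
    by (simp add: word_prod_def rmult_def)
  ultimately show ?case unfolding sym_group_mult by (simp only:)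
qed

lemma W_J_eq:
  assumes n: "n = sum_list lam"
  shows "W_J lam = {u. u permutes {1..n} \<and> (\<forall>p\<in>{1..n}. blk lam (u p) = blk lam p)}"
    (is "_ = ?W")
proof -
  let ?G = "sym_group n" and ?J = "J_set lam"
  have J: "cox_gen i \<in> ?J" if "i \<in> {1..<n}" "blk lam i = blk lam (Suc i)" for i
    using that J_set_eq[OF n] by auto
  have "u \<in> ?W" if "u \<in> generate ?G ?J" for u
    using that
  proof (induction rule: generate.induct)
    case one
    then show ?case using permutes_id[of "{1..n}"] by (simp add: sym_group_def id_def)
  next
    case (incl h)
    then show ?case using J_set_eq[OF n] cox_gen_permutes[of _ n] by (force simp: cox_gen_preserves)
  next
    case (inv h)
    then obtain i where i: "h = cox_gen i" "i \<in> {1..<n}" "blk lam i = blk lam (Suc i)"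
      using J_set_eq[OF n] by auto
    have h: "h permutes {1..n}" using i cox_gen_permutes[of i n] by simp
    then have "m_inv ?G h = inv_into UNIV h"
      by (intro sym_group_inv_equality) (simp add: sym_group_def)
    also have "\<dots> = h" using i by (simp add: cox_gen_def)
    finally show ?case using i h by (simp add: cox_gen_preserves)
  next
    case (eng h1 h2)
    then have h: "h1 permutes {1..n}" "h2 permutes {1..n}" by auto
    then have perm: "h1 \<circ> h2 permutes {1..n}" by (simp only: permutes_compose)
    have preserves: "blk lam ((h1 \<circ> h2) p) = blk lam p" if "p \<in> {1..n}" for p
      using eng that permutes_in_image[OF h(2), of p] by simp
    show ?case
      unfolding sym_group_mult using perm preserves by blast
  qed
  moreover have "word_prod vs \<in> generate ?G ?J"
    if "set vs \<subseteq> {i \<in> {1..<n}. blk lam i = blk lam (Suc i)}" for vs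
    by (rule word_prod_in_generate) (use that J in blast)
  moreover have "\<exists>vs. set vs \<subseteq> {i \<in> {1..<n}. blk lam i = blk lam (Suc i)} \<and> u = word_prod vs"
    if "u \<in> ?W" for u
  proof -
    have "u permutes {1..n}" "\<And>p. p \<in> {1..n} \<Longrightarrow> blk lam (u p) = blk lam p"
      using that by auto
    then obtain vs where "set vs \<subseteq> {i \<in> {1..<n}. blk lam i = blk lam (Suc i)}"
      "u = word_prod vs \<circ> id"
      using inversions_subset_imp_word[OF mono_blk[of lam], where y = u and x = id and n = n]
        permutes_id[of "{1..n}"] by (metis empty_subsetI id_apply inversions_id)
    then show ?thesis by (metis comp_id)
  qed
  ultimately show ?thesis unfolding W_J_def n[symmetric] by blast
qed

text \<open>The permutation reversing each block.\<close>

definition brev :: "nat list \<Rightarrow> nat \<Rightarrow> nat" where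
  "brev lam p = (if p \<in> {1..sum_list lam}
     then sum_list (take (blk lam p - 1) lam) + sum_list (take (blk lam p) lam) + 1 - p else p)"

lemma brev_in_block:
  assumes p: "p \<in> {1..sum_list lam}"
  shows "brev lam p \<in> {1..sum_list lam}" "blk lam (brev lam p) = blk lam p"
    "brev lam (brev lam p) = p"
proof -
  define a where "a = blk lam p - 1"
  have a: "blk lam p = Suc a" "a < length lam"
    using blk_ge_1[of lam p] blk_le_length[of p lam] p unfolding a_def by auto
  have le: "sum_list (take (Suc a) lam) \<le> sum_list lam"
    by (metis append_take_drop_id le_add1 sum_list_append)
  have p': "sum_list (take a lam) < p" "p \<le> sum_list (take (Suc a) lam)"
    using blk_eq_iff[OF _ _ a(2), of p] p a by auto
  have b: "brev lam p = sum_list (take a lam) + sum_list (take (Suc a) lam) + 1 - p"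
    using p a by (simp add: brev_def)
  have q: "sum_list (take a lam) < brev lam p" "brev lam p \<le> sum_list (take (Suc a) lam)"
    using b p' by auto
  then show 1: "brev lam p \<in> {1..sum_list lam}" using le by auto
  show 2: "blk lam (brev lam p) = blk lam p"
    using blk_eq_iff[OF _ _ a(2), of "brev lam p"] 1 q a by auto
  have "brev lam (brev lam p) = sum_list (take a lam) + sum_list (take (Suc a) lam) + 1 - brev lam p"
    unfolding brev_def[of lam "brev lam p"] using 1 2 a by simp
  then show "brev lam (brev lam p) = p" using b p' by auto
qed

lemma brev_permutes: "brev lam permutes {1..sum_list lam}"
proof (rule bij_imp_permutes)
  show "bij_betw (brev lam) {1..sum_list lam} {1..sum_list lam}"
    by (rule bij_betw_byWitness[where f' = "brev lam"]) (use brev_in_block in blast)+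
qed (auto simp: brev_def)

lemma brev_decreasing:
  assumes "1 \<le> p" "p < q" "q \<le> sum_list lam" "blk lam p = blk lam q"
  shows "brev lam q < brev lam p"
proof -
  have "brev lam p \<ge> 1" using brev_in_block[of p lam] assms by auto
  moreover have "brev lam q \<ge> 1" using brev_in_block[of q lam] assms by auto
  ultimately show ?thesis using assms unfolding brev_def by (auto split: if_splits)
qed

lemma longest_W_J_eq:
  assumes n: "n = sum_list lam"
  shows "longest_W_J lam = brev lam"
proof -
  have brev: "brev lam \<in> W_J lam"
    using brev_permutes[of lam] brev_in_block[of _ lam] n by (auto simp: W_J_eq[OF n])
  have sub: "inversions n u \<subseteq> inversions n (brev lam)" if u: "u \<in> W_J lam" for u
  proof
    fix x assume "x \<in> inversions n u"
    then obtain i j where x: "x = (i, j)" "1 \<le> i" "i < j" "j \<le> n" "u j < u i"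
      by (auto simp: inversions_def)
    have "blk lam (u j) \<le> blk lam (u i)" using x by (simp add: blk_mono)
    then have "blk lam j \<le> blk lam i" using u x by (simp add: W_J_eq[OF n])
    moreover have "blk lam i \<le> blk lam j" using x by (simp add: blk_mono)
    ultimately show "x \<in> inversions n (brev lam)"
      using brev_decreasing[of i j lam] x n by (auto simp: inversions_def)
  qed
  have len: "cox_length (sum_list lam) u = card (inversions n u)" if "u \<in> W_J lam" for u
    using that cox_length_eq_card_inversions[of u n] n by (simp add: W_J_eq[OF n])
  show ?thesis unfolding longest_W_J_def
  proof (rule the_equality)
    show "brev lam \<in> W_J lam \<and>
      (\<forall>u\<in>W_J lam. cox_length (sum_list lam) u \<le> cox_length (sum_list lam) (brev lam))"
      using brev sub len by (auto simp: card_mono)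
  next
    fix w
    assume w: "w \<in> W_J lam \<and>
      (\<forall>u\<in>W_J lam. cox_length (sum_list lam) u \<le> cox_length (sum_list lam) w)"
    then have "card (inversions n (brev lam)) \<le> card (inversions n w)"
      using brev len by metis
    then have "inversions n w = inversions n (brev lam)"
      using sub w by (intro card_seteq) auto
    then show "w = brev lam"
      using inversions_inject[of w n "brev lam"] w brev by (simp add: W_J_eq[OF n])
  qed
qed

text \<open>Permutations whose row-form increases along each block.\<close>

definition block_increasing :: "nat list \<Rightarrow> (nat \<Rightarrow> nat) \<Rightarrow> bool" where
  "block_increasing lam d \<longleftrightarrow> d permutes {1..sum_list lam} \<and>
     (\<forall>i j. 1 \<le> i \<and> i < j \<and> j \<le> sum_list lam \<and> blk lam i = blk lam j \<longrightarrow> d i < d j)"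

lemma min_coset_reps_eq:
  assumes n: "n = sum_list lam"
  shows "min_coset_reps lam = {d. block_increasing lam d}"
proof (intro equalityI subsetI, unfold mem_Collect_eq)
  fix d
  assume d: "d \<in> min_coset_reps lam"
    then have perm: "d permutes {1..n}" by (simp add: min_coset_reps_def n)
    have ascent: "d i < d (Suc i)" if i: "1 \<le> i" "i < n" "blk lam i = blk lam (Suc i)" for i
    proof (rule ccontr)
      assume "\<not> d i < d (Suc i)"
      moreover have "d i \<noteq> d (Suc i)" using permutes_inj[OF perm] by (metis injD n_not_Suc_n)
      ultimately have lt: "d (Suc i) < d i" by simp
      have "cox_gen i \<in> W_J lam"
        using i cox_gen_permutes[of i n] by (simp add: W_J_eq[OF n] cox_gen_preserves)
      then have "cox_length n d \<le> cox_length n (d \<circ> cox_gen i)"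
        using d unfolding min_coset_reps_def n rmult_def by blast
      moreover have "d \<circ> cox_gen i permutes {1..n}"
        using perm i by (intro permutes_compose cox_gen_permutes)
      ultimately show False
        using card_inversions_descent[OF perm i(1,2) lt] perm
        by (simp add: cox_length_eq_card_inversions)
    qed
    have "d i < d j" if "i < j" "1 \<le> i" "j \<le> n" "blk lam i = blk lam j" for i j
      using that
    proof (induction j rule: less_induct)
      case (less j)
      have b: "blk lam i \<le> blk lam (j - 1)" "blk lam (j - 1) \<le> blk lam j"
        using less.prems(1) by (intro blk_mono; simp)+
      have "d (j - 1) < d j" using ascent[of "j - 1"] less.prems b by simp
      moreover have "d i < d (j - 1)" if "i \<noteq> j - 1"
        using that less.prems b by (intro less.IH) auto
      ultimately show ?case by (cases "i = j - 1") auto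
    qed
    then show "block_increasing lam d"
      using perm by (simp add: block_increasing_def n)
next
  fix d
  assume d: "block_increasing lam d"
    then have perm: "d permutes {1..n}" by (simp add: block_increasing_def n)
    have "cox_length n d \<le> cox_length n (d \<circ> u)" if u: "u \<in> W_J lam" for u
    proof -
      have u_perm: "u permutes {1..n}" and u_blk: "\<And>p. p \<in> {1..n} \<Longrightarrow> blk lam (u p) = blk lam p"
        using u by (auto simp: W_J_eq[OF n])
      let ?v = "inv_into UNIV u"
      have v: "?v p \<in> {1..n}" "u (?v p) = p" "blk lam (?v p) = blk lam p" if "p \<in> {1..n}" for p
        using that u_blk permutes_inverses[OF u_perm] permutes_in_image[OF permutes_inv[OF u_perm], of p]
        by metis+
      \<comment> \<open>All inversions of \<open>d\<close> are between different blocks, and \<open>u\<close> only moves them.\<close>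
      have "map_prod ?v ?v ` inversions n d \<subseteq> inversions n (d \<circ> u)"
      proof
        fix z assume "z \<in> map_prod ?v ?v ` inversions n d"
        then obtain i j where z: "z = (?v i, ?v j)" and "(i, j) \<in> inversions n d" by auto
        then have ij: "i \<in> {1..n}" "j \<in> {1..n}" "i < j" "d j < d i" by (auto simp: inversions_def)
        then have "blk lam i \<noteq> blk lam j" using d n unfolding block_increasing_def by (metis atLeastAtMost_iff less_asym)
        then have "blk lam i < blk lam j" using blk_mono[of i j lam] ij by simp
        then have "blk lam (?v i) < blk lam (?v j)" using v(3) ij by simp
        then have "?v i < ?v j" using blk_mono[of "?v j" "?v i" lam] by (meson leD leI)
        then show "z \<in> inversions n (d \<circ> u)"
          using v(1)[OF ij(1)] v(1)[OF ij(2)] v(2)[OF ij(1)] v(2)[OF ij(2)] ij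
          by (simp add: inversions_iff z)
      qed
      moreover have "inj (map_prod ?v ?v)"
        by (intro prod.inj_map permutes_inj[OF permutes_inv[OF u_perm]])
      then have "inj_on (map_prod ?v ?v) (inversions n d)"
        by (rule inj_on_subset) simp
      ultimately have "card (inversions n d) \<le> card (inversions n (d \<circ> u))"
        by (intro card_inj_on_le[of "map_prod ?v ?v"]) auto
      moreover have "d \<circ> u permutes {1..n}" using u_perm perm by (rule permutes_compose)
      ultimately show ?thesis using perm by (simp only: cox_length_eq_card_inversions)
    qed
    then show "d \<in> min_coset_reps lam"
      using perm by (simp add: min_coset_reps_def n[symmetric] rmult_def)
qed

section \<open>Robinson--Schensted insertion\<close>

text \<open>The pair of tableaux after the first \<open>n\<close> letters, and its first component.\<close>

definition rs_state :: "nat \<Rightarrow> (nat \<Rightarrow> nat) \<Rightarrow> nat list list \<times> nat list list" where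
  "rs_state n w = fold rs_step (map (\<lambda>i. (i, w i)) [1..<Suc n]) ([], [])"

definition insertion_tableau :: "nat \<Rightarrow> (nat \<Rightarrow> nat) \<Rightarrow> nat list list" where
  "insertion_tableau n w = fst (rs_state n w)"

lemma insertion_tableau_0 [simp]: "insertion_tableau 0 w = []"
  by (simp add: insertion_tableau_def rs_state_def)

lemma recording_tableau_0 [simp]: "recording_tableau 0 w = []"
  by (simp add: recording_tableau_def)

lemma rs_state_Suc: "rs_state (Suc n) w = rs_step (Suc n, w (Suc n)) (rs_state n w)"
  by (simp add: rs_state_def)

lemma recording_tableau_eq: "recording_tableau n w = snd (rs_state n w)"
  by (simp add: recording_tableau_def rs_state_def)

lemma insertion_tableau_Suc:
  "insertion_tableau (Suc n) w = fst (tab_insert (w (Suc n)) (insertion_tableau n w))"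
  by (cases "rs_state n w")
    (simp add: insertion_tableau_def rs_state_Suc split: prod.split)

lemma recording_tableau_Suc:
  "recording_tableau (Suc n) w =
     append_to_row (Suc n) (snd (tab_insert (w (Suc n)) (insertion_tableau n w))) (recording_tableau n w)"
  by (cases "rs_state n w")
    (simp add: recording_tableau_eq insertion_tableau_def rs_state_Suc split: prod.split)

lemma insertion_tableau_cong:
  "(\<And>i. 1 \<le> i \<Longrightarrow> i \<le> n \<Longrightarrow> w i = w' i) \<Longrightarrow> insertion_tableau n w = insertion_tableau n w'"
  by (induction n) (simp_all add: insertion_tableau_Suc)

lemma recording_tableau_cong:
  "(\<And>i. 1 \<le> i \<Longrightarrow> i \<le> n \<Longrightarrow> w i = w' i) \<Longrightarrow> recording_tableau n w = recording_tableau n w'"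
proof (induction n)
  case (Suc n)
  then show ?case
    using insertion_tableau_cong[of n w w'] by (simp add: recording_tableau_Suc)
qed simp

text \<open>Relabelling the letters monotonically relabels the tableau and keeps the recording tableau.\<close>

lemma row_insert_map:
  assumes "strict_mono f"
  shows "row_insert (f x) (map f r) = (case row_insert x r of (r', b) \<Rightarrow> (map f r', map_option f b))"
  using strict_mono_less[OF assms] by (induction r) (auto split: prod.split)

lemma tab_insert_map:
  assumes "strict_mono f"
  shows "tab_insert (f x) (map (map f) P) = (case tab_insert x P of (P', k) \<Rightarrow> (map (map f) P', k))"
proof (induction P arbitrary: x)
  case (Cons r P)
  then show ?case
    by (auto simp: row_insert_map[OF assms] split: prod.split option.split)
qed simp

lemma insertion_tableau_map:
  assumes "strict_mono f"
  shows "insertion_tableau n (f \<circ> w) = map (map f) (insertion_tableau n w)"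
  by (induction n) (simp_all add: insertion_tableau_Suc tab_insert_map[OF assms] split: prod.split)

lemma recording_tableau_map:
  assumes "strict_mono f"
  shows "recording_tableau n (f \<circ> w) = recording_tableau n w"
proof (induction n)
  case (Suc n)
  have "snd (tab_insert ((f \<circ> w) (Suc n)) (insertion_tableau n (f \<circ> w))) =
      snd (tab_insert (w (Suc n)) (insertion_tableau n w))"
    unfolding insertion_tableau_map[OF assms] comp_apply tab_insert_map[OF assms]
    by (simp split: prod.split)
  then show ?case using Suc unfolding recording_tableau_Suc by (simp only:)
qed simp

lemma length_row_insert:
  "length (fst (row_insert x r)) = (if snd (row_insert x r) = None then Suc (length r) else length r)"
  by (induction r) (auto split: prod.splits)

lemma length_tab_insert:
  "map length (fst (tab_insert x P)) =
     (let k = snd (tab_insert x P); s = map length P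
      in if k < length P then s[k := Suc (s ! k)] else s @ [1])"
  "snd (tab_insert x P) \<le> length P"
proof (induction P arbitrary: x)
  case (Cons r P)
  {
    case 1
    obtain r' b where r: "row_insert x r = (r', b)" by fastforce
    show ?case
    proof (cases b)
      case None
      then show ?thesis using length_row_insert[of x r] r by (simp add: Let_def)
    next
      case (Some y)
      obtain P' k where "tab_insert y P = (P', k)" by fastforce
      then show ?thesis using length_row_insert[of x r] Cons(1)[of y] r Some
        by (simp add: Let_def)
    qed
  next
    case 2
    show ?case using Cons(2) by (auto split: prod.split option.split) (metis snd_conv)
  }
qed simp_all

lemma length_append_to_row:
  "map length (append_to_row i k Q) =
     (let s = map length Q in if k < length Q then s[k := Suc (s ! k)] else s @ [1])"
  by (auto simp: append_to_row_def Let_def map_update)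

lemma shape_insertion_recording:
  "map length (insertion_tableau n w) = map length (recording_tableau n w)"
proof (induction n)
  case (Suc n)
  then have "length (insertion_tableau n w) = length (recording_tableau n w)"
    by (metis length_map)
  then show ?case
    using Suc by (simp add: insertion_tableau_Suc recording_tableau_Suc length_tab_insert
        length_append_to_row Let_def)
qed simp

lemma set_append_to_row:
  assumes "r \<in> set (append_to_row i k Q)"
  shows "r \<in> set Q \<or> r = [i] \<or> (\<exists>q \<in> set Q. r = q @ [i])"
proof (cases "k < length Q")
  case True
  then have "r \<in> set Q \<or> r = Q ! k @ [i]"
    using assms set_update_subset_insert[of Q k "Q ! k @ [i]"] by (auto simp: append_to_row_def)
  then show ?thesis using nth_mem[OF True] by blast
qed (use assms in \<open>auto simp: append_to_row_def\<close>)

lemma recording_tableau_entries: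
  "r \<in> set (recording_tableau n w) \<Longrightarrow> r \<noteq> [] \<and> set r \<subseteq> {1..n}"
proof (induction n arbitrary: r)
  case (Suc n)
  let ?Q = "recording_tableau n w"
  have "r \<in> set ?Q \<or> r = [Suc n] \<or> (\<exists>q \<in> set ?Q. r = q @ [Suc n])"
    using Suc.prems set_append_to_row unfolding recording_tableau_Suc by blast
  then show ?case using Suc.IH by fastforce
qed simp

text \<open>
  If \<open>i\<close> is a new entry, then deleting it, together with a row that becomes empty, undoes the
  step; and the row that contains \<open>i\<close> tells where it was put.
\<close>

lemma append_to_row_inject:
  assumes Q: "\<And>r. r \<in> set Q \<Longrightarrow> r \<noteq> [] \<and> i \<notin> set r" "k \<le> length Q"
    and Q': "\<And>r. r \<in> set Q' \<Longrightarrow> r \<noteq> [] \<and> i \<notin> set r" "k' \<le> length Q'"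
    and eq: "append_to_row i k Q = append_to_row i k' Q'"
  shows "Q = Q' \<and> k = k'"
proof -
  define strip where "strip T = filter (\<lambda>r. r \<noteq> []) (map (filter (\<lambda>x. x \<noteq> i)) T)" for T
  have strip: "strip (append_to_row i k Q) = Q"
    if Q: "\<And>r. r \<in> set Q \<Longrightarrow> r \<noteq> [] \<and> i \<notin> set r" for k Q
  proof -
    have *: "filter (\<lambda>x. x \<noteq> i) r = r" if "r \<in> set Q" for r
      using Q[OF that] by (auto simp: filter_id_conv)
    have "map (filter (\<lambda>x. x \<noteq> i)) Q = Q"
      using * by (simp add: map_idI)
    moreover have "filter (\<lambda>r. r \<noteq> []) Q = Q" using Q by (simp add: filter_id_conv)
    moreover have "Q[k := Q ! k] = Q" by simp
    ultimately show ?thesis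
      using * unfolding strip_def append_to_row_def by (auto simp: map_update)
  qed
  have loc: "(\<exists>r. j < length T \<and> T ! j = r \<and> i \<in> set r) \<longleftrightarrow> j = k"
    if T: "T = append_to_row i k Q" and Q: "\<And>r. r \<in> set Q \<Longrightarrow> r \<noteq> [] \<and> i \<notin> set r" and "k \<le> length Q"
    for j k T Q
    using that by (auto simp: append_to_row_def nth_list_update nth_append in_set_conv_nth)
  have "Q = Q'" using strip[OF Q(1)] strip[OF Q'(1)] eq by metis
  moreover have "k = k'"
    using loc[OF refl Q] loc[OF refl Q'] eq by metis
  ultimately show ?thesis by simp
qed

text \<open>The recording tableau determines in which row each step has grown.\<close>

lemma recording_tableau_Suc_eq_iff:
  "recording_tableau (Suc n) w = recording_tableau (Suc n) w' \<longleftrightarrow>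
     recording_tableau n w = recording_tableau n w' \<and>
     snd (tab_insert (w (Suc n)) (insertion_tableau n w)) =
     snd (tab_insert (w' (Suc n)) (insertion_tableau n w'))"
proof
  assume eq: "recording_tableau (Suc n) w = recording_tableau (Suc n) w'"
  have *: "r \<noteq> [] \<and> Suc n \<notin> set r" if "r \<in> set (recording_tableau n w)" for r w
    using recording_tableau_entries[OF that] by auto
  have "length (recording_tableau n w) = length (insertion_tableau n w)" for w
    using shape_insertion_recording[of n w] by (metis length_map)
  then have le: "snd (tab_insert x (insertion_tableau n w)) \<le> length (recording_tableau n w)" for x w
    using length_tab_insert(2) by simp
  show "recording_tableau n w = recording_tableau n w' \<and>
     snd (tab_insert (w (Suc n)) (insertion_tableau n w)) =
     snd (tab_insert (w' (Suc n)) (insertion_tableau n w'))"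
    using eq unfolding recording_tableau_Suc by (intro append_to_row_inject[OF * le * le])
qed (simp add: recording_tableau_Suc)

lemma row_insert_None_iff: "snd (row_insert x r) = None \<longleftrightarrow> (\<forall>y\<in>set r. y \<le> x)"
  by (induction r) (auto split: prod.split)

lemma row_insert_at_end: "\<forall>y\<in>set r. y \<le> x \<Longrightarrow> row_insert x r = (r @ [x], None)"
  by (induction r) auto

text \<open>The first row of a tableau is empty if the tableau is.\<close>

definition first_row :: "nat list list \<Rightarrow> nat list" where
  "first_row P = (case P of [] \<Rightarrow> [] | r # rs \<Rightarrow> r)"

lemma tab_insert_first_row_iff:
  "snd (tab_insert x P) = 0 \<longleftrightarrow> (\<forall>y \<in> set (first_row P). y \<le> x)"
proof (cases P)
  case (Cons r P')
  then show ?thesis using row_insert_None_iff[of x r]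
    by (auto simp: first_row_def split: prod.split option.split)
qed (simp add: first_row_def)

lemma first_row_tab_insert:
  "snd (tab_insert x P) = 0 \<Longrightarrow> first_row (fst (tab_insert x P)) = first_row P @ [x]"
proof (cases P)
  case (Cons r P')
  assume "snd (tab_insert x P) = 0"
  then have "\<forall>y\<in>set r. y \<le> x"
    unfolding tab_insert_first_row_iff by (simp add: Cons first_row_def)
  then show ?thesis using Cons by (simp add: row_insert_at_end first_row_def)
qed (simp add: first_row_def)

lemma set_row_insert: "set (fst (row_insert x r)) \<subseteq> insert x (set r)"
  "snd (row_insert x r) = Some y \<Longrightarrow> y \<in> set r"
  by (induction r) (auto split: prod.splits if_splits)

lemma set_tab_insert: "\<Union> (set ` set (fst (tab_insert x P))) \<subseteq> insert x (\<Union> (set ` set P))"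
proof (induction P arbitrary: x)
  case (Cons r P)
  obtain r' b where r: "row_insert x r = (r', b)" by fastforce
  show ?case
  proof (cases b)
    case None
    then show ?thesis using r set_row_insert(1)[of x r] by auto
  next
    case (Some y)
    obtain P' k where P': "tab_insert y P = (P', k)" by fastforce
    have "set r' \<subseteq> insert x (set r)" "y \<in> set r"
      using r Some set_row_insert(1)[of x r] set_row_insert(2)[of x r y] by simp_all
    moreover have "\<Union> (set ` set P') \<subseteq> insert y (\<Union> (set ` set P))"
      using Cons[of y] P' by simp
    moreover have "fst (tab_insert x (r # P)) = r' # P'" using r Some P' by simp
    ultimately show ?thesis by auto
  qed
qed simp

lemma set_insertion_tableau: "\<Union> (set ` set (insertion_tableau n w)) \<subseteq> w ` {1..n}"
proof (induction n)
  case (Suc n)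
  have "w ` {1..Suc n} = insert (w (Suc n)) (w ` {1..n})"
    by (simp add: atLeastAtMostSuc_conv)
  then show ?case
    using set_tab_insert[of "w (Suc n)" "insertion_tableau n w"] Suc
    unfolding insertion_tableau_Suc by blast
qed simp

section \<open>Increasing subsequences from the shape\<close>

text \<open>
  A list of pairs is a word whose letters carry colours. A colouring is good if each of the
  colours below \<open>k\<close> marks a weakly increasing subsequence; letters with other colours belong
  to no subsequence.
\<close>

definition colour_class :: "nat \<Rightarrow> (nat \<times> nat) list \<Rightarrow> nat list" where
  "colour_class c cs = map fst (filter (\<lambda>x. snd x = c) cs)"

definition good_colouring :: "nat \<Rightarrow> (nat \<times> nat) list \<Rightarrow> bool" where
  "good_colouring k cs \<longleftrightarrow> (\<forall>c<k. sorted (colour_class c cs))"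

text \<open>The word has \<open>k\<close> disjoint weakly increasing subsequences with at least \<open>N\<close> letters in total.\<close>

definition coverable :: "nat \<Rightarrow> nat list \<Rightarrow> nat \<Rightarrow> bool" where
  "coverable k w N \<longleftrightarrow> (\<exists>cs. map fst cs = w \<and> good_colouring k cs \<and>
     N \<le> length (filter (\<lambda>x. snd x < k) cs))"

lemma colour_class_simps [simp]:
  "colour_class c [] = []"
  "colour_class c (x # cs) = (if snd x = c then [fst x] else []) @ colour_class c cs"
  "colour_class c (cs @ ds) = colour_class c cs @ colour_class c ds"
  by (auto simp: colour_class_def)

text \<open>Moving a smaller letter from right to left of a larger one merges no colour classes.\<close>

lemma coverable_swap:
  assumes "y < z" "coverable k (u @ [z, y] @ v) N"
  shows "coverable k (u @ [y, z] @ v) N"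
proof -
  obtain cs where cs: "map fst cs = u @ [z, y] @ v" "good_colouring k cs"
    "N \<le> length (filter (\<lambda>x. snd x < k) cs)"
    using assms by (auto simp: coverable_def)
  obtain us i j vs where d: "cs = us @ [(z, i), (y, j)] @ vs" "map fst us = u" "map fst vs = v"
    using cs(1) by (auto simp: map_eq_append_conv map_eq_Cons_conv)
  have ne: "i \<noteq> j \<or> k \<le> i"
  proof (rule ccontr)
    assume "\<not> ?thesis"
    then have "sorted (colour_class i cs)" "i = j" using cs(2) by (auto simp: good_colouring_def)
    then show False using assms(1) d(1) by (auto simp: sorted_append)
  qed
  have "colour_class c (us @ [(y, j), (z, i)] @ vs) = colour_class c cs" if "c < k" for c
    using d ne that by auto
  then have "good_colouring k (us @ [(y, j), (z, i)] @ vs)"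
    using cs(2) unfolding good_colouring_def by metis
  moreover have "N \<le> length (filter (\<lambda>x. snd x < k) (us @ [(y, j), (z, i)] @ vs))"
    using cs(3) d(1) by auto
  ultimately show ?thesis
    unfolding coverable_def using d by (intro exI[of _ "us @ [(y, j), (z, i)] @ vs"]) simp
qed

text \<open>
  The substantial Knuth move. If \<open>x\<close> and \<open>z\<close> lie in the same subsequence, then \<open>z\<close> and what
  follows it are moved behind \<open>y\<close>. If \<open>y\<close> belonged to no subsequence, it replaces \<open>x\<close>;
  otherwise what followed \<open>y\<close> is attached to \<open>x\<close>.
\<close>

lemma coverable_knuth:
  assumes "x < y" "y \<le> z" "coverable k (u @ [y, x, z] @ v) N"
  shows "coverable k (u @ [y, z, x] @ v) N"
proof -
  obtain cs where cs: "map fst cs = u @ [y, x, z] @ v" "good_colouring k cs"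
    "N \<le> length (filter (\<lambda>x. snd x < k) cs)"
    using assms by (auto simp: coverable_def)
  obtain us j i i' vs where d: "cs = us @ [(y, j), (x, i), (z, i')] @ vs" "map fst us = u" "map fst vs = v"
    using cs(1) by (auto simp: map_eq_append_conv map_eq_Cons_conv)
  have sorted: "sorted (colour_class c cs)" if "c < k" for c
    using cs(2) that by (simp add: good_colouring_def)
  have ij: "i \<noteq> j \<or> k \<le> i"
  proof (rule ccontr)
    assume "\<not> ?thesis"
    then show False using sorted[of i] assms(1) d(1) by (auto simp: sorted_append)
  qed
  show ?thesis
  proof (cases "i = i' \<and> i < k")
    case False
    let ?ds = "us @ [(y, j), (z, i'), (x, i)] @ vs"
    have "colour_class c ?ds = colour_class c cs" if "c < k" for c
      using d False that by auto
    then have "good_colouring k ?ds" using cs(2) unfolding good_colouring_def by metis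
    moreover have "N \<le> length (filter (\<lambda>x. snd x < k) ?ds)"
      using cs(3) d(1) by auto
    ultimately show ?thesis
      unfolding coverable_def using d by (intro exI[of _ ?ds]) simp
  next
    case True
    show ?thesis
    proof (cases "j < k")
      case False
      let ?ds = "us @ [(y, i), (z, i), (x, j)] @ vs"
      have "sorted (colour_class c ?ds)" if "c < k" for c
      proof (cases "c = i")
        case c: True
        have "sorted (colour_class i us @ [x, z] @ colour_class i vs)"
          using sorted[of i] True False ij d(1) by auto
        then have "sorted (colour_class i us @ [y, z] @ colour_class i vs)"
          using assms(1,2) by (force simp: sorted_append)
        moreover have "colour_class i ?ds = colour_class i us @ [y, z] @ colour_class i vs"
          using True False by auto
        ultimately show ?thesis using c by (simp only:)
      next
        case c: False
        then show ?thesis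
          using sorted[OF that] d(1) True False that by auto
      qed
      then have "good_colouring k ?ds" unfolding good_colouring_def by blast
      moreover have "N \<le> length (filter (\<lambda>x. snd x < k) ?ds)"
        using cs(3) d(1) True False by auto
      ultimately show ?thesis
        unfolding coverable_def using d by (intro exI[of _ ?ds]) simp
    next
      case j: True
      let ?vs = "map (\<lambda>(a, c). (a, transpose i j c)) vs"
      let ?ds = "us @ [(y, j), (z, j), (x, i)] @ ?vs"
      have vs: "colour_class c ?vs = colour_class (transpose i j c) vs" for c
      proof -
        have *: "transpose i j b = c \<longleftrightarrow> b = transpose i j c" for b
          by (metis transpose_involutory)
        show ?thesis
          by (induction vs)
            (simp_all only: list.map colour_class_simps case_prod_beta fst_conv snd_conv *)
      qed
      have "i < k" "i \<noteq> j" "i' = i" using True ij by auto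
      have "sorted (colour_class c ?ds)" if "c < k" for c
      proof -
        consider "c = i" | "c = j" | "c \<noteq> i" "c \<noteq> j" by blast
        then show ?thesis
        proof cases
          case 1
          have "sorted (colour_class i us @ [x])" "sorted (y # colour_class j vs)"
            using sorted[of i] sorted[of j] \<open>i < k\<close> \<open>i \<noteq> j\<close> \<open>i' = i\<close> j d(1)
            by (auto simp: sorted_append)
          then have "sorted (colour_class i us @ [x] @ colour_class j vs)"
            using assms(1) by (fastforce simp: sorted_append)
          moreover have "colour_class c ?ds = colour_class i us @ [x] @ colour_class j vs"
            using \<open>i \<noteq> j\<close> 1 vs by simp
          ultimately show ?thesis by (simp only:)
        next
          case 2
          have "sorted (colour_class j us @ [y])" "sorted (z # colour_class i vs)"
            using sorted[of i] sorted[of j] \<open>i < k\<close> \<open>i \<noteq> j\<close> \<open>i' = i\<close> j d(1)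
            by (auto simp: sorted_append)
          then have "sorted (colour_class j us @ [y, z] @ colour_class i vs)"
            using assms(2) by (fastforce simp: sorted_append)
          moreover have "colour_class c ?ds = colour_class j us @ [y, z] @ colour_class i vs"
            using \<open>i \<noteq> j\<close> 2 vs by simp
          ultimately show ?thesis by (simp only:)
        next
          case 3
          then show ?thesis
            using sorted[OF that] \<open>i' = i\<close> d(1) by (auto simp: vs)
        qed
      qed
      then have "good_colouring k ?ds" unfolding good_colouring_def by blast
      moreover have "map fst ?vs = v" using d(3) by (simp add: case_prod_beta comp_def)
      moreover have "length (filter (\<lambda>x. snd x < k) ?vs) = length (filter (\<lambda>x. snd x < k) vs)"
        using \<open>i < k\<close> j by (induction vs) (auto simp: transpose_def split: if_splits)
      then have "N \<le> length (filter (\<lambda>x. snd x < k) ?ds)"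
        using cs(3) d(1) True \<open>i < k\<close> j by auto
      ultimately show ?thesis
        unfolding coverable_def using d by (intro exI[of _ ?ds]) simp
    qed
  qed
qed

lemma coverable_swap_past:
  assumes "coverable k (u @ [y] @ as @ v) N" "\<forall>a\<in>set as. a < y"
  shows "coverable k (u @ as @ [y] @ v) N"
  using assms
proof (induction as arbitrary: u)
  case (Cons a as)
  have "coverable k ((u @ [a]) @ [y] @ as @ v) N"
    using coverable_swap[of a y k u "as @ v" N] Cons.prems by simp
  then show ?case using Cons.IH[of "u @ [a]"] Cons.prems by simp
qed simp

lemma coverable_knuth_past:
  assumes "coverable k (u @ [y, x] @ bs @ v) N" "x < y" "sorted (y # bs)"
  shows "coverable k (u @ [y] @ bs @ [x] @ v) N"
  using assms
proof (induction bs arbitrary: u y)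
  case (Cons b bs)
  have "coverable k ((u @ [y]) @ [b, x] @ bs @ v) N"
    using coverable_knuth[of x y b k u "bs @ v" N] Cons.prems by simp
  then show ?case using Cons.IH[of "u @ [y]" b] Cons.prems by auto
qed simp

lemma row_insert_Some:
  assumes "row_insert x r = (r', Some y)"
  shows "\<exists>as bs. r = as @ y # bs \<and> r' = as @ x # bs \<and> x < y \<and> (\<forall>a\<in>set as. a \<le> x)"
  using assms
proof (induction r arbitrary: r')
  case (Cons a r)
  show ?case
  proof (cases "x < a")
    case True
    then show ?thesis using Cons.prems by (intro exI[of _ "[]"] exI[of _ r]) auto
  next
    case False
    then obtain r'' where r'': "row_insert x r = (r'', Some y)" "r' = a # r''"
      using Cons.prems by (auto split: prod.splits)
    from Cons.IH[OF this(1)] obtain as bs where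
      "r = as @ y # bs \<and> r'' = as @ x # bs \<and> x < y \<and> (\<forall>a\<in>set as. a \<le> x)" by blast
    then show ?thesis using False r'' by (intro exI[of _ "a # as"] exI[of _ bs]) auto
  qed
qed simp

lemma row_insert_None: "row_insert x r = (r', None) \<Longrightarrow> r' = r @ [x]"
  by (induction r arbitrary: r') (auto split: prod.splits if_splits)

lemma sorted_row_insert:
  assumes "sorted r"
  shows "sorted (fst (row_insert x r))"
proof -
  obtain r' b where r: "row_insert x r = (r', b)" by fastforce
  show ?thesis
  proof (cases b)
    case None
    then show ?thesis using r row_insert_None[of x r r'] row_insert_None_iff[of x r] assms
      by (auto simp: sorted_append)
  next
    case (Some y)
    then obtain as bs where "r = as @ y # bs \<and> r' = as @ x # bs \<and> x < y \<and> (\<forall>a\<in>set as. a \<le> x)"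
      using row_insert_Some[of x r r' y] r by blast
    then show ?thesis using r assms by (auto simp: sorted_append)
  qed
qed

lemma sorted_tab_insert:
  "\<forall>r\<in>set P. sorted r \<Longrightarrow> \<forall>r\<in>set (fst (tab_insert x P)). sorted r"
proof (induction P arbitrary: x)
  case (Cons r P)
  then show ?case
    using sorted_row_insert[of r x] by (auto split: prod.split option.split) (metis fst_conv)+
qed simp

lemma sorted_insertion_tableau: "\<forall>r\<in>set (insertion_tableau n w). sorted r"
  by (induction n) (simp_all add: insertion_tableau_Suc sorted_tab_insert)

text \<open>The reading word lists the rows from bottom to top.\<close>

definition reading_word :: "nat list list \<Rightarrow> nat list" where
  "reading_word P = concat (rev P)"

lemma coverable_row_insert:
  assumes "sorted r" "row_insert x r = (r', Some y)" "coverable k (u @ [y] @ r' @ v) N"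
  shows "coverable k (u @ r @ [x] @ v) N"
proof -
  obtain as bs where r: "r = as @ y # bs" "r' = as @ x # bs" "x < y" "\<forall>a\<in>set as. a \<le> x"
    using row_insert_Some[OF assms(2)] by blast
  have "coverable k ((u @ as) @ [y, x] @ bs @ v) N"
    using coverable_swap_past[of k u y as "x # bs @ v" N] assms(3) r by fastforce
  then show ?thesis
    using coverable_knuth_past[of k "u @ as" y x bs v N] r assms(1) by (simp add: sorted_append)
qed

lemma coverable_tab_insert:
  assumes "\<forall>r\<in>set P. sorted r" "coverable k (reading_word (fst (tab_insert x P)) @ v) N"
  shows "coverable k (reading_word P @ [x] @ v) N"
  using assms
proof (induction P arbitrary: x v)
  case Nil
  then show ?case by (simp add: reading_word_def)
next
  case (Cons r P)
  obtain r' b where r: "row_insert x r = (r', b)" by fastforce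
  show ?case
  proof (cases b)
    case None
    then show ?thesis using Cons.prems r row_insert_None[of x r r'] by (simp add: reading_word_def)
  next
    case (Some y)
    have "coverable k (reading_word (fst (tab_insert y P)) @ r' @ v) N"
      using Cons.prems r Some by (simp add: reading_word_def split: prod.splits)
    then have "coverable k (reading_word P @ [y] @ r' @ v) N"
      using Cons.IH[of y "r' @ v"] Cons.prems by simp
    then show ?thesis
      using coverable_row_insert[of r x r' y k "reading_word P" v N] Cons.prems r Some
      by (simp add: reading_word_def)
  qed
qed

lemma coverable_insertion_tableau:
  assumes "coverable k (reading_word (insertion_tableau n w) @ v) N"
  shows "coverable k (map w [1..<Suc n] @ v) N"
  using assms
proof (induction n arbitrary: v)
  case (Suc n)
  then have "coverable k (reading_word (insertion_tableau n w) @ [w (Suc n)] @ v) N"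
    using coverable_tab_insert[OF sorted_insertion_tableau] by (simp add: insertion_tableau_Suc)
  then show ?case using Suc.IH[of "w (Suc n) # v"] by simp
qed (simp add: reading_word_def)

text \<open>In the reading word, the first \<open>k\<close> rows are increasing subsequences.\<close>

lemma coverable_reading_word:
  assumes "\<forall>r\<in>set P. sorted r"
  shows "coverable k (reading_word P) (sum_list (take k (map length P)))"
proof -
  define cs where "cs a P = concat (rev (map (\<lambda>(i, r). map (\<lambda>x. (x, i)) r) (enumerate a P)))"
    for a and P :: "nat list list"
  have cs_Cons: "cs a (r # P) = cs (Suc a) P @ map (\<lambda>x. (x, a)) r" for a r P
    by (simp add: cs_def)
  have cs_Nil: "cs a [] = []" for a by (simp add: cs_def)
  have "map fst (cs a P) = reading_word P" for a
    by (induction P arbitrary: a) (simp_all add: cs_Cons cs_Nil reading_word_def comp_def)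
  moreover have "sorted (colour_class c (cs a P)) \<and> (c < a \<longrightarrow> colour_class c (cs a P) = [])" for c a
    using assms
  proof (induction P arbitrary: a)
    case (Cons r P)
    have "colour_class c (map (\<lambda>x. (x, a)) r) = (if c = a then r else [])"
      by (induction r) auto
    then show ?case using Cons.IH[of "Suc a"] Cons.prems by (auto simp: cs_Cons)
  qed (simp add: cs_Nil)
  then have "good_colouring k (cs 0 P)" by (simp add: good_colouring_def)
  moreover have "length (filter (\<lambda>x. snd x < a + k) (cs a P)) = sum_list (take k (map length P))" for a
  proof (induction P arbitrary: a k)
    case (Cons r P)
    have "b \<le> snd x" if "x \<in> set (cs b P)" for x b
      using that by (induction P arbitrary: b) (fastforce simp: cs_Nil cs_Cons)+
    then have none: "filter (\<lambda>x. snd x < a) (cs (Suc a) P) = []"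
      by (fastforce simp: filter_empty_conv)
    have "length (filter (\<lambda>x. snd x < a + k) (map (\<lambda>x. (x, a)) r)) = (if k = 0 then 0 else length r)"
      by (induction r) auto
    then show ?case
      using Cons.IH[of "Suc a" "k - 1"] none by (cases k) (auto simp: cs_Cons)
  qed (simp add: cs_Nil)
  from this[of 0] have "length (filter (\<lambda>x. snd x < k) (cs 0 P)) = sum_list (take k (map length P))"
    by simp
  ultimately show ?thesis unfolding coverable_def by (metis order_refl)
qed

text \<open>
  One half of Greene's theorem: there are \<open>k\<close> disjoint increasing subsequences which together
  are as long as the first \<open>k\<close> rows of the tableau.
\<close>

theorem greene_lower_bound:
  "\<exists>f. (\<forall>p\<in>{1..n}. \<forall>q\<in>{1..n}. p < q \<and> f p = f q \<and> f p < k \<longrightarrow> w p \<le> w q) \<and>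
     sum_list (take k (map length (insertion_tableau n w))) \<le> card {p \<in> {1..n}. f p < (k::nat)}"
proof -
  have "coverable k (map w [1..<Suc n]) (sum_list (take k (map length (insertion_tableau n w))))"
    using coverable_insertion_tableau[of k n w "[]"] 
      coverable_reading_word[OF sorted_insertion_tableau, of k n w] by simp
  then obtain cs where cs: "map fst cs = map w [1..<Suc n]" "good_colouring k cs"
    "sum_list (take k (map length (insertion_tableau n w))) \<le> length (filter (\<lambda>x. snd x < k) cs)"
    by (auto simp: coverable_def)
  have len: "length cs = n" using cs(1) by (metis length_map length_upt diff_Suc_1)
  define f where "f p = snd (cs ! (p - 1))" for p
  have fst: "fst (cs ! i) = w (Suc i)" if "i < n" for i
    using arg_cong[OF cs(1), of "\<lambda>xs. xs ! i"] that len by (simp del: upt_Suc)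
  have "w p \<le> w q" if pq: "p \<in> {1..n}" "q \<in> {1..n}" "p < q" "f p = f q" "f p < k" for p q
  proof -
    let ?P = "\<lambda>x. snd x = f p"
    let ?i = "p - 1" and ?j = "q - 1"
    have ij: "?i < ?j" "?j < length cs" using pq len by auto
    have letter: "fst (cs ! ?j) = w q" "snd (cs ! ?j) = f p"
      using fst[of ?j] pq len by (auto simp: f_def)
    have "colour_class (f p) cs = colour_class (f p) (take ?j cs @ cs ! ?j # drop (Suc ?j) cs)"
      using id_take_nth_drop[OF ij(2)] by simp
    also have "\<dots> = colour_class (f p) (take ?j cs) @ w q # colour_class (f p) (drop (Suc ?j) cs)"
      using letter by simp
    finally have "colour_class (f p) cs
      = colour_class (f p) (take ?j cs) @ w q # colour_class (f p) (drop (Suc ?j) cs)" .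
    moreover have mem: "w p \<in> set (colour_class (f p) (take ?j cs))"
    proof -
      have "cs ! ?i \<in> set (take ?j cs)" using ij by (metis in_set_conv_nth length_take min.absorb4 nth_take less_trans order_less_imp_le min_def)
      moreover have "snd (cs ! ?i) = f p" "fst (cs ! ?i) = w p" using fst[of ?i] ij pq len by (auto simp: f_def)
      ultimately show ?thesis unfolding colour_class_def by force
    qed
    moreover have "sorted (colour_class (f p) cs)" using cs(2) pq by (simp add: good_colouring_def)
    ultimately have "sorted (colour_class (f p) (take ?j cs) @ w q # colour_class (f p) (drop (Suc ?j) cs))"
      by (simp only:)
    then show ?thesis using mem by (metis list.set_intros(1) sorted_append)
  qed
  moreover have "length (filter (\<lambda>x. snd x < k) cs) = card {p \<in> {1..n}. f p < k}"
  proof -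
    have "length (filter (\<lambda>x. snd x < k) cs) = card {i. i < n \<and> snd (cs ! i) < k}"
      using len by (simp add: length_filter_conv_card)
    also have "\<dots> = card (Suc ` {i. i < n \<and> snd (cs ! i) < k})" by (simp add: card_image)
    also have "Suc ` {i. i < n \<and> snd (cs ! i) < k} = {p \<in> {1..n}. f p < k}"
    proof (intro equalityI subsetI)
      fix p assume "p \<in> {p \<in> {1..n}. f p < k}"
      then show "p \<in> Suc ` {i. i < n \<and> snd (cs ! i) < k}"
        by (intro image_eqI[of _ _ "p - 1"]) (auto simp: f_def)
    qed (auto simp: f_def)
    finally show ?thesis .
  qed
  ultimately show ?thesis using cs(3) by (intro exI[of _ f]) auto
qed

section \<open>The tableau of the longest element\<close>

text \<open>
  Adding a vertical strip: the \<open>j\<close>-th entry of the list goes to the end of the \<open>j\<close>-th row, which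
  is new if the tableau has fewer rows.
\<close>

fun add_strip :: "nat list list \<Rightarrow> nat list \<Rightarrow> nat list list" where
  "add_strip P [] = P"
| "add_strip [] (z # zs) = [z] # add_strip [] zs"
| "add_strip (r # P) (z # zs) = (r @ [z]) # add_strip P zs"

lemma row_insert_bump_last:
  "\<forall>y\<in>set r. y \<le> z \<Longrightarrow> z < z' \<Longrightarrow> row_insert z (r @ [z']) = (r @ [z], Some z')"
  by (induction r) auto

lemma tab_insert_add_strip:
  assumes "\<forall>r\<in>set P. \<forall>y\<in>set r. y \<le> z" "sorted_wrt (<) (z # zs)"
  shows "fst (tab_insert z (add_strip P zs)) = add_strip P (z # zs)"
  using assms
proof (induction P zs arbitrary: z rule: add_strip.induct)
  case (1 P)
  then show ?case by (cases P) (auto simp: row_insert_at_end)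
next
  case (2 z' zs)
  then show ?case using 2(1)[of z'] by (simp add: case_prod_beta)
next
  case (3 r P z' zs)
  have "\<forall>r\<in>set P. \<forall>y\<in>set r. y \<le> z'" using 3(2,3) by force
  then have "fst (tab_insert z' (add_strip P zs)) = add_strip P (z' # zs)"
    using 3(1)[of z'] 3(3) by simp
  moreover have "row_insert z (r @ [z']) = (r @ [z], Some z')"
    using 3(2,3) by (intro row_insert_bump_last) auto
  ultimately show ?case by (simp add: case_prod_beta)
qed

lemma sum_length_add_strip:
  "sum_list (take k (map length (add_strip P zs))) = sum_list (take k (map length P)) + min k (length zs)"
proof (induction P zs arbitrary: k rule: add_strip.induct)
  case (2 z zs)
  then show ?case by (cases k) auto
next
  case (3 r P z zs)
  then show ?case by (cases k) auto
qed simp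

lemma brev_snoc:
  "brev (lam @ [m]) p = (if p \<in> {sum_list lam<..sum_list lam + m}
     then 2 * sum_list lam + m + 1 - p else brev lam p)"
proof (cases "1 \<le> p \<and> p \<le> sum_list lam + m")
  case True
  show ?thesis
  proof (cases "p \<le> sum_list lam")
    case p: True
    have "blk lam p \<le> length lam" using True p by (intro blk_le_length) auto
    then show ?thesis using True p by (simp add: brev_def blk_snoc)
  next
    case False
    then show ?thesis using True by (simp add: brev_def blk_snoc)
  qed
qed (auto simp: brev_def)

lemma insertion_tableau_brev_snoc:
  assumes "j \<le> m"
  shows "insertion_tableau (sum_list lam + j) (brev (lam @ [m])) =
    add_strip (insertion_tableau (sum_list lam) (brev lam))
      [Suc (sum_list lam + m) - j..<Suc (sum_list lam + m)]"
  using assms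
proof (induction j)
  case 0
  have "insertion_tableau (sum_list lam) (brev (lam @ [m])) = insertion_tableau (sum_list lam) (brev lam)"
    by (intro insertion_tableau_cong) (simp add: brev_snoc)
  then show ?case by simp
next
  case (Suc j)
  let ?n = "sum_list lam" and ?P = "insertion_tableau (sum_list lam) (brev lam)"
  have val: "brev (lam @ [m]) (Suc (?n + j)) = ?n + m - j"
    using Suc.prems by (simp add: brev_snoc)
  have upt: "[?n + m - j..<Suc (?n + m)] = (?n + m - j) # [Suc (?n + m) - j..<Suc (?n + m)]"
    using Suc.prems by (subst upt_conv_Cons) (auto simp: Suc_diff_le)
  have "\<forall>r\<in>set ?P. \<forall>y\<in>set r. y \<le> ?n"
  proof (intro ballI)
    fix r y assume "r \<in> set ?P" "y \<in> set r"
    then have "y \<in> brev lam ` {1..?n}" using set_insertion_tableau[of ?n "brev lam"] by blast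
    then show "y \<le> ?n" using brev_in_block(1)[of _ lam] by auto
  qed
  then have "\<forall>r\<in>set ?P. \<forall>y\<in>set r. y \<le> ?n + m - j" using Suc.prems by force
  moreover have "sorted_wrt (<) [?n + m - j..<Suc (?n + m)]" by (rule sorted_wrt_upt)
  ultimately show ?case
    using Suc tab_insert_add_strip[of ?P "?n + m - j" "[Suc (?n + m) - j..<Suc (?n + m)]"]
    unfolding upt[symmetric] by (simp add: insertion_tableau_Suc val del: upt_Suc)
qed

text \<open>
  In the tableau of the longest element, a block of length \<open>m\<close> contributes one letter to each of
  the first \<open>m\<close> rows.
\<close>

lemma shape_brev:
  "sum_list (take k (map length (insertion_tableau (sum_list lam) (brev lam)))) = (\<Sum>m\<leftarrow>lam. min k m)"
proof (induction lam rule: rev_induct)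
  case (snoc m lam)
  have "insertion_tableau (sum_list (lam @ [m])) (brev (lam @ [m])) =
      add_strip (insertion_tableau (sum_list lam) (brev lam)) [Suc (sum_list lam)..<Suc (sum_list lam + m)]"
    using insertion_tableau_brev_snoc[of m m lam] by (simp del: upt_Suc)
  then show ?case using snoc by (simp add: sum_length_add_strip del: upt_Suc)
qed simp

section \<open>Appending a value\<close>

text \<open>Moves up the values from \<open>t\<close> on, so that \<open>t\<close> is no longer a value.\<close>

definition shift_from :: "nat \<Rightarrow> nat \<Rightarrow> nat" where
  "shift_from t v = (if t \<le> v then Suc v else v)"

lemma strict_mono_shift_from: "strict_mono (shift_from t)"
  by (auto simp: strict_mono_def shift_from_def)

lemma shift_from_less_iff [simp]: "shift_from t u < shift_from t v \<longleftrightarrow> u < v"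
  by (auto simp: shift_from_def)

lemma shift_from_neq [simp]: "shift_from t v \<noteq> t" "t \<noteq> shift_from t v"
  by (auto simp: shift_from_def)

lemma shift_from_le_iff: "shift_from t v \<le> t \<longleftrightarrow> v < t"
  by (auto simp: shift_from_def)

text \<open>
  The permutation of \<open>{1..n + 1}\<close> with last value \<open>t\<close> whose first \<open>n\<close> values are in the same
  relative order as those of \<open>d\<close>.
\<close>

definition append_value :: "nat \<Rightarrow> (nat \<Rightarrow> nat) \<Rightarrow> nat \<Rightarrow> nat \<Rightarrow> nat" where
  "append_value n d t i = (if i \<le> n then shift_from t (d i) else if i = Suc n then t else i)"

lemma permutes_finiteI:
  "finite S \<Longrightarrow> (\<And>i. i \<in> S \<Longrightarrow> f i \<in> S) \<Longrightarrow> inj_on f S \<Longrightarrow> (\<And>i. i \<notin> S \<Longrightarrow> f i = i) \<Longrightarrow> f permutes S"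
  by (intro bij_imp_permutes bij_betw_imageI endo_inj_surj image_subsetI)

lemma append_value_permutes:
  assumes d: "d permutes {1..n}" and t: "t \<in> {1..Suc n}"
  shows "append_value n d t permutes {1..Suc n}"
proof (rule permutes_finiteI)
  have range: "d i \<in> {1..n}" if "1 \<le> i" "i \<le> n" for i
    using permutes_in_image[OF d, of i] that by simp
  show "append_value n d t i \<in> {1..Suc n}" if "i \<in> {1..Suc n}" for i
    using range[of i] t that by (auto simp: append_value_def shift_from_def)
  show "inj_on (append_value n d t) {1..Suc n}"
  proof (rule inj_onI)
    fix i j assume ij: "i \<in> {1..Suc n}" "j \<in> {1..Suc n}" "append_value n d t i = append_value n d t j"
    show "i = j"
    proof (cases "i \<le> n \<and> j \<le> n")
      case True
      then have "d i = d j"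
        using ij strict_mono_eq[OF strict_mono_shift_from[of t]] by (simp add: append_value_def)
      then show ?thesis by (rule injD[OF permutes_inj[OF d]])
    next
      case False
      then show ?thesis using ij by (auto simp: append_value_def split: if_splits)
    qed
  qed
next
  fix i assume i: "i \<notin> {1..Suc n}"
  show "append_value n d t i = i"
  proof (cases "i = 0")
    case True
    then show ?thesis using permutes_not_in[OF d, of 0] t by (simp add: append_value_def shift_from_def)
  qed (use i in \<open>simp add: append_value_def\<close>)
qed simp

lemma append_value_exhaust:
  assumes e: "e permutes {1..Suc n}"
  obtains d t where "d permutes {1..n}" "t \<in> {1..Suc n}" "e = append_value n d t"
proof -
  define t where "t = e (Suc n)"
  define unshift where "unshift v = (if t < v then v - 1 else v)" for v
  define d where "d i = (if i \<in> {1..n} then unshift (e i) else i)" for i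
  have t: "t \<in> {1..Suc n}"
    unfolding t_def using permutes_in_image[OF e, of "Suc n"] by simp
  have unshift: "shift_from t (unshift v) = v" if "v \<noteq> t" for v
    using that by (auto simp: shift_from_def unshift_def)
  have ne: "e i \<noteq> t" if "i \<noteq> Suc n" for i
    unfolding t_def using that injD[OF permutes_inj[OF e]] by blast
  have range: "e i \<in> {1..Suc n}" if "i \<in> {1..n}" for i
    using permutes_in_image[OF e, of i] that by simp
  have d: "d permutes {1..n}"
  proof (rule permutes_finiteI)
    show "d i \<in> {1..n}" if "i \<in> {1..n}" for i
      using range[OF that] ne[of i] that t by (auto simp: d_def unshift_def)
    show "inj_on d {1..n}"
    proof (rule inj_onI)
      fix i j assume ij: "i \<in> {1..n}" "j \<in> {1..n}" "d i = d j"
      then have "unshift (e i) = unshift (e j)" by (simp add: d_def)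
      moreover have "i \<noteq> Suc n" "j \<noteq> Suc n" using ij by auto
      ultimately have "e i = e j" using unshift ne by metis
      then show "i = j" by (rule injD[OF permutes_inj[OF e]])
    qed
  qed (auto simp: d_def)
  have "e i = append_value n d t i" for i
  proof (cases "i \<in> {1..n}")
    case True
    then show ?thesis using unshift[OF ne, of i] by (simp add: append_value_def d_def)
  next
    case False
    then consider "i = 0" | "i = Suc n" | "i > Suc n" by force
    then show ?thesis
    proof cases
      case 1
      then show ?thesis
        using permutes_not_in[OF e, of 0] permutes_not_in[OF d, of 0] t by (simp add: append_value_def shift_from_def)
    next
      case 2
      then show ?thesis by (simp add: append_value_def t_def)
    next
      case 3
      then show ?thesis using permutes_not_in[OF e, of i] by (simp add: append_value_def)
    qed
  qed
  then show thesis using that d t by blast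
qed

lemma inversions_append_value:
  "inversions (Suc n) (append_value n d t) = inversions n d \<union> {(i, Suc n) | i. 1 \<le> i \<and> i \<le> n \<and> t \<le> d i}"
proof -
  have "(i, j) \<in> inversions (Suc n) (append_value n d t) \<longleftrightarrow>
    (i, j) \<in> inversions n d \<union> {(i, Suc n) | i. 1 \<le> i \<and> i \<le> n \<and> t \<le> d i}" for i j
    by (cases "j \<le> n") (auto simp: inversions_def append_value_def shift_from_def)
  then show ?thesis by auto
qed

lemma block_increasing_append_value_iff:
  assumes n: "n = sum_list lam" and d: "d permutes {1..n}" and t: "t \<in> {1..Suc n}"
  shows "block_increasing (lam @ [1]) (append_value n d t) \<longleftrightarrow> block_increasing lam d"
proof -
  have "(1 \<le> i \<and> i < j \<and> j \<le> Suc n \<and> blk (lam @ [1]) i = blk (lam @ [1]) j \<longrightarrow>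
      append_value n d t i < append_value n d t j) \<longleftrightarrow>
    (1 \<le> i \<and> i < j \<and> j \<le> n \<and> blk lam i = blk lam j \<longrightarrow> d i < d j)" for i j
  proof (cases "1 \<le> i \<and> i < j \<and> j \<le> Suc n")
    case True
    then have "blk lam i \<le> length lam" using n by (intro blk_le_length) auto
    then show ?thesis using True n by (auto simp: blk_snoc append_value_def le_Suc_eq)
  qed auto
  then show ?thesis
    using d append_value_permutes[OF d t] n by (simp add: block_increasing_def)
qed

lemma Z_set_eq:
  assumes "composition lam n"
  shows "Z_set lam = {e. block_increasing lam e \<and>
    recording_tableau n (e \<circ> brev lam) = recording_tableau n (brev lam)}"
proof -
  have n: "n = sum_list lam" using assms by (simp add: composition_def)
  show ?thesis
    unfolding Z_set_def min_coset_reps_eq[OF n] right_cell_equiv_def longest_W_J_eq[OF n] rmult_def n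
    by simp
qed

lemma Z_set_permutes: "composition lam n \<Longrightarrow> d \<in> Z_set lam \<Longrightarrow> d permutes {1..n}"
  by (auto simp: Z_set_eq block_increasing_def composition_def)

text \<open>
  The essential reduction. As the last block of \<open>lam\<close> is a single position, the last step of the
  insertion of the longest element extends the first row. For an element \<open>d\<close> of the set
  \<^const>\<open>Z_set\<close> the value \<open>d n\<close> thus stands at the end of the first row, and a further value
  extends this row if and only if it is larger.
\<close>

lemma append_value_in_Z_set_iff:
  assumes lam: "composition lam n" "lam = mu @ [1]"
    and d: "d permutes {1..n}" and t: "t \<in> {1..Suc n}"
  shows "append_value n d t \<in> Z_set (lam @ [1]) \<longleftrightarrow> d \<in> Z_set lam \<and> d n < t"
proof -
  have n: "n = sum_list lam" using lam by (simp add: composition_def)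
  have lam': "composition (lam @ [1]) (Suc n)" using lam(1) by (simp add: composition_def)
  obtain m where m: "n = Suc m" using n lam(2) by simp
  let ?b = "brev lam" and ?P = "insertion_tableau n (d \<circ> brev lam)"
  have b': "brev (lam @ [1]) = ?b"
  proof
    show "brev (lam @ [1]) p = ?b p" for p
      unfolding brev_snoc using n by (auto simp: brev_def)
  qed
  have b_le: "?b i \<le> n" if "i \<le> n" for i
  proof (cases "i \<in> {1..n}")
    case True
    then show ?thesis using brev_in_block(1)[of i lam] n by simp
  qed (use that n in \<open>auto simp: brev_def\<close>)
  have "?b n = n" unfolding lam(2) brev_snoc using n lam(2) by simp
  moreover have "?b (Suc n) = Suc n" using n by (simp add: brev_def)
  ultimately have bn: "?b n = n" "?b (Suc n) = Suc n" .
  have max_first: "snd (tab_insert v (insertion_tableau k ?b)) = 0"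
    if "\<And>i. 1 \<le> i \<Longrightarrow> i \<le> k \<Longrightarrow> ?b i \<le> v" for v k
  proof -
    have "y \<le> v" if "y \<in> set (first_row (insertion_tableau k ?b))" for y
    proof -
      have "y \<in> \<Union> (set ` set (insertion_tableau k ?b))"
        using that by (cases "insertion_tableau k ?b") (auto simp: first_row_def)
      then show ?thesis using set_insertion_tableau[of k ?b] \<open>\<And>i. _ \<Longrightarrow> _ \<Longrightarrow> ?b i \<le> v\<close> by auto
    qed
    then show ?thesis by (simp add: tab_insert_first_row_iff)
  qed
  have restr: "(append_value n d t \<circ> ?b) i = (shift_from t \<circ> (d \<circ> ?b)) i" if "i \<le> n" for i
    using b_le[OF that] by (simp add: append_value_def)
  have P: "insertion_tableau n (append_value n d t \<circ> ?b) = map (map (shift_from t)) ?P"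
    unfolding insertion_tableau_map[OF strict_mono_shift_from, symmetric]
    by (intro insertion_tableau_cong restr)
  have Q: "recording_tableau n (append_value n d t \<circ> ?b) = recording_tableau n (d \<circ> ?b)"
    unfolding recording_tableau_map[OF strict_mono_shift_from, of n t "d \<circ> ?b", symmetric]
    by (intro recording_tableau_cong restr)
  have first: "first_row (map (map (shift_from t)) ?P) = map (shift_from t) (first_row ?P)"
    by (simp add: first_row_def split: list.split)
  have "snd (tab_insert ((append_value n d t \<circ> ?b) (Suc n)) (insertion_tableau n (append_value n d t \<circ> ?b))) = 0
      \<longleftrightarrow> (\<forall>y\<in>set (first_row ?P). y < t)"
    unfolding P by (simp add: tab_insert_first_row_iff first bn append_value_def shift_from_le_iff)
  moreover have "snd (tab_insert (?b (Suc n)) (insertion_tableau n ?b)) = 0"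
    using b_le bn by (intro max_first) (simp add: le_SucI)
  ultimately have step: "recording_tableau (Suc n) (append_value n d t \<circ> ?b) = recording_tableau (Suc n) ?b \<longleftrightarrow>
      recording_tableau n (d \<circ> ?b) = recording_tableau n ?b \<and> (\<forall>y\<in>set (first_row ?P). y < t)"
    unfolding recording_tableau_Suc_eq_iff Q by simp
  have last: "(\<forall>y\<in>set (first_row ?P). y < t) \<longleftrightarrow> d n < t"
    if eq: "recording_tableau n (d \<circ> ?b) = recording_tableau n ?b"
  proof -
    have "snd (tab_insert ((d \<circ> ?b) n) (insertion_tableau m (d \<circ> ?b))) =
        snd (tab_insert (?b n) (insertion_tableau m ?b))"
      using eq unfolding m recording_tableau_Suc_eq_iff by simp
    also have "\<dots> = 0" using b_le bn m by (intro max_first) simp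
    finally have 0: "snd (tab_insert (d n) (insertion_tableau m (d \<circ> ?b))) = 0"
      using bn by simp
    have "?P = fst (tab_insert (d n) (insertion_tableau m (d \<circ> ?b)))"
      using bn by (simp add: m insertion_tableau_Suc)
    then have "first_row ?P = first_row (insertion_tableau m (d \<circ> ?b)) @ [d n]"
      using first_row_tab_insert[OF 0] by simp
    then show ?thesis using 0 by (auto simp: tab_insert_first_row_iff)
  qed
  show ?thesis
    using block_increasing_append_value_iff[OF n d t] step last
    unfolding Z_set_eq[OF lam'] Z_set_eq[OF lam(1)] b' by auto
qed

section \<open>The order isomorphism\<close>

lemma Y_set_eq:
  assumes "composition lam n"
  shows "Y_set lam = {x \<in> Z_set lam. \<forall>y \<in> Z_set lam. inversions n x \<subseteq> inversions n y \<longrightarrow> y = x}"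
proof -
  have n: "sum_list lam = n" using assms by (simp add: composition_def)
  have "is_prefix n x y \<longleftrightarrow> inversions n x \<subseteq> inversions n y" if "x \<in> Z_set lam" "y \<in> Z_set lam" for x y
    using that by (intro is_prefix_iff_inversions_subset Z_set_permutes[OF assms])
  then show ?thesis unfolding Y_set_def n by blast
qed

text \<open>The extension by the smallest value larger than the last one.\<close>

definition append_next :: "nat \<Rightarrow> (nat \<Rightarrow> nat) \<Rightarrow> nat \<Rightarrow> nat" where
  "append_next n d = append_value n d (Suc (d n))"

text \<open>The new inversions \<open>(i, n + 1)\<close> mirror the inversions \<open>(i, n)\<close>.\<close>

lemma inversions_append_next_subset_iff:
  assumes n: "1 \<le> n"
  shows "inversions (Suc n) (append_next n d) \<subseteq> inversions (Suc n) (append_next n d') \<longleftrightarrow>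
    inversions n d \<subseteq> inversions n d'"
proof -
  have mem: "(i, j) \<in> inversions (Suc n) (append_next n d) \<longleftrightarrow>
      (i, j) \<in> inversions n d \<or> j = Suc n \<and> (i, n) \<in> inversions n d" for i j d
    using n unfolding append_next_def inversions_append_value
    by (cases "i = n") (auto simp: inversions_iff Suc_le_eq)
  have "(i, Suc n) \<notin> inversions n d" for i d by (simp add: inversions_def)
  then show ?thesis unfolding subset_iff split_paired_All mem by blast
qed

theorem bij_betw_append_next:
  assumes lam: "composition lam n" "lam = mu @ [1]"
  shows "bij_betw (append_next n) (Y_set lam) (Y_set (lam @ [1]))"
proof -
  have lam': "composition (lam @ [1]) (Suc n)" using lam(1) by (simp add: composition_def)
  have n: "1 \<le> n" using lam by (auto simp: composition_def)
  have last: "d n \<in> {1..n}" if "d permutes {1..n}" for d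
    using permutes_in_image[OF that, of n] n by simp
  have append_next_Z: "append_next n d \<in> Z_set (lam @ [1])" if "d \<in> Z_set lam" for d
    using append_value_in_Z_set_iff[OF lam, of d "Suc (d n)"] that last[of d] Z_set_permutes[OF lam(1) that]
    by (simp add: append_next_def)
  have cofinal: "\<exists>d\<in>Z_set lam. inversions (Suc n) e \<subseteq> inversions (Suc n) (append_next n d)"
    if e: "e \<in> Z_set (lam @ [1])" for e
  proof -
    obtain d t where dt: "d permutes {1..n}" "t \<in> {1..Suc n}" "e = append_value n d t"
      using append_value_exhaust[OF Z_set_permutes[OF lam' e]] by blast
    then have "d \<in> Z_set lam" "d n < t"
      using append_value_in_Z_set_iff[OF lam dt(1,2)] e by auto
    then show ?thesis unfolding dt(3) append_next_def inversions_append_value by (intro bexI[of _ d]) auto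
  qed
  have antisym: "x = y" if "x \<in> Z_set ks" "y \<in> Z_set ks" "composition ks k"
    "inversions k x \<subseteq> inversions k y" "inversions k y \<subseteq> inversions k x" for x y ks k
    using that inversions_inject[of x k y] Z_set_permutes by blast
  note mono = inversions_append_next_subset_iff[OF n]
  have inj: "inj_on (append_next n) (Z_set lam)"
    using antisym[OF _ _ lam(1)] mono by (intro inj_onI) (metis order_refl)
  have "append_next n d \<in> Y_set (lam @ [1])" if "d \<in> Y_set lam" for d
  proof -
    have d: "d \<in> Z_set lam" "\<And>y. y \<in> Z_set lam \<Longrightarrow> inversions n d \<subseteq> inversions n y \<Longrightarrow> y = d"
      using that by (auto simp: Y_set_eq[OF lam(1)])
    have "e = append_next n d" if "e \<in> Z_set (lam @ [1])" "inversions (Suc n) (append_next n d) \<subseteq> inversions (Suc n) e" for e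
    proof -
      obtain d' where d': "d' \<in> Z_set lam" "inversions (Suc n) e \<subseteq> inversions (Suc n) (append_next n d')"
        using cofinal[OF \<open>e \<in> _\<close>] by blast
      then have "d' = d" using d mono that by (meson order_trans)
      then show ?thesis using antisym[OF _ _ lam'] that d' append_next_Z d(1) by blast
    qed
    then show ?thesis unfolding Y_set_eq[OF lam'] using append_next_Z[OF d(1)] by blast
  qed
  moreover have "e \<in> append_next n ` Y_set lam" if "e \<in> Y_set (lam @ [1])" for e
  proof -
    have e: "e \<in> Z_set (lam @ [1])"
      "\<And>y. y \<in> Z_set (lam @ [1]) \<Longrightarrow> inversions (Suc n) e \<subseteq> inversions (Suc n) y \<Longrightarrow> y = e"
      using that unfolding Y_set_eq[OF lam'] by blast+
    obtain d where d: "d \<in> Z_set lam" "inversions (Suc n) e \<subseteq> inversions (Suc n) (append_next n d)"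
      using cofinal[OF e(1)] by blast
    then have ed: "append_next n d = e" using e(2) append_next_Z by blast
    have "y = d" if "y \<in> Z_set lam" "inversions n d \<subseteq> inversions n y" for y
    proof -
      have "append_next n y = e" using e(2)[OF append_next_Z[OF that(1)]] that(2) mono ed by blast
      then show ?thesis using inj ed that(1) d(1) by (auto dest: inj_onD)
    qed
    then have "d \<in> Y_set lam" using d(1) by (auto simp: Y_set_eq[OF lam(1)])
    then show ?thesis using ed by blast
  qed
  moreover have "inj_on (append_next n) (Y_set lam)"
    using inj by (rule inj_on_subset) (auto simp: Y_set_def)
  ultimately show ?thesis by (auto simp: bij_betw_def)
qed

section \<open>Diagrams with a given permutation\<close>

text \<open>The ranks with respect to a total order number the elements increasingly from 1.\<close>

lemma rank_bij_betw:
  assumes fin: "finite D"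
    and refl: "\<And>x. x \<in> D \<Longrightarrow> R x x"
    and trans: "\<And>x y z. R x y \<Longrightarrow> R y z \<Longrightarrow> R x z"
    and antisym: "\<And>x y. x \<in> D \<Longrightarrow> y \<in> D \<Longrightarrow> R x y \<Longrightarrow> R y x \<Longrightarrow> x = y"
    and total: "\<And>x y. x \<in> D \<Longrightarrow> y \<in> D \<Longrightarrow> R x y \<or> R y x"
  shows "bij_betw (\<lambda>x. card {y \<in> D. R y x}) D {1..card D}"
    and "\<And>x y. x \<in> D \<Longrightarrow> y \<in> D \<Longrightarrow> card {z \<in> D. R z x} \<le> card {z \<in> D. R z y} \<longleftrightarrow> R x y"
proof -
  let ?f = "\<lambda>x. card {y \<in> D. R y x}"
  have less: "?f x < ?f y" if "x \<in> D" "y \<in> D" "R x y" "x \<noteq> y" for x y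
  proof (rule psubset_card_mono)
    show "finite {z \<in> D. R z y}" using fin by simp
    have "y \<in> {z \<in> D. R z y}" "y \<notin> {z \<in> D. R z x}"
      using that refl antisym by blast+
    moreover have "{z \<in> D. R z x} \<subseteq> {z \<in> D. R z y}" using that trans by blast
    ultimately show "{z \<in> D. R z x} \<subset> {z \<in> D. R z y}" by blast
  qed
  show iff: "?f x \<le> ?f y \<longleftrightarrow> R x y" if "x \<in> D" "y \<in> D" for x y
  proof
    assume "R x y"
    then show "?f x \<le> ?f y" using less[OF that] by (cases "x = y") auto
  next
    assume "?f x \<le> ?f y"
    then have "\<not> (R y x \<and> y \<noteq> x)" using less[OF that(2,1)] by auto
    then show "R x y" using total[OF that] refl[OF that(1)] by auto
  qed
  have inj: "inj_on ?f D"
  proof (rule inj_onI)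
    fix x y assume xy: "x \<in> D" "y \<in> D" "?f x = ?f y"
    then have "R x y" "R y x" using iff[OF xy(1,2)] iff[OF xy(2,1)] by simp_all
    then show "x = y" using antisym xy by blast
  qed
  have "?f x \<in> {1..card D}" if "x \<in> D" for x
  proof -
    have "x \<in> {y \<in> D. R y x}" using that refl by blast
    then have "0 < ?f x" using fin card_gt_0_iff by fastforce
    moreover have "?f x \<le> card D" using fin by (intro card_mono) auto
    ultimately show ?thesis by simp
  qed
  then have "?f ` D \<subseteq> {1..card D}" by blast
  moreover have "card (?f ` D) = card {1..card D}" using inj by (simp add: card_image)
  ultimately have "?f ` D = {1..card D}" by (intro card_subset_eq) auto
  then show "bij_betw ?f D {1..card D}" using inj by (simp add: bij_betw_def)
qed

text \<open>The two reading orders of nodes, as reflexive relations: by rows and by columns.\<close>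

definition row_order :: "nat \<times> nat \<Rightarrow> nat \<times> nat \<Rightarrow> bool" where
  "row_order x y \<longleftrightarrow> fst x < fst y \<or> (fst x = fst y \<and> snd x \<le> snd y)"

definition col_order :: "nat \<times> nat \<Rightarrow> nat \<times> nat \<Rightarrow> bool" where
  "col_order x y \<longleftrightarrow> snd x < snd y \<or> (snd x = snd y \<and> fst x \<le> fst y)"

lemma row_filling_eq: "row_filling D x = card {y \<in> D. row_order y x}"
  unfolding row_filling_def row_order_def by (cases x) (auto intro!: arg_cong[where f = card])

lemma col_filling_eq: "col_filling D x = card {y \<in> D. col_order y x}"
  unfolding col_filling_def col_order_def by (cases x) (auto intro!: arg_cong[where f = card])

lemma row_filling_bij:
  assumes "finite D"
  shows "bij_betw (row_filling D) D {1..card D}"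
    and "x \<in> D \<Longrightarrow> y \<in> D \<Longrightarrow> row_filling D x \<le> row_filling D y \<longleftrightarrow> row_order x y"
  unfolding row_filling_eq
  by (rule rank_bij_betw; use assms in \<open>auto simp: row_order_def prod_eq_iff\<close>)+

lemma col_filling_bij:
  assumes "finite D"
  shows "bij_betw (col_filling D) D {1..card D}"
    and "x \<in> D \<Longrightarrow> y \<in> D \<Longrightarrow> col_filling D x \<le> col_filling D y \<longleftrightarrow> col_order x y"
  unfolding col_filling_eq
  by (rule rank_bij_betw; use assms in \<open>auto simp: col_order_def prod_eq_iff\<close>)+

text \<open>
  A diagram with row-composition \<open>lam\<close> and permutation \<open>d\<close> is given by the function that
  sends the entry of a node in the filling by columns to the column of the node. It starts at 1,
  increases by at most one at each step, and can only be constant at a step that leads to a lower row.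
\<close>

definition column_labelling :: "nat list \<Rightarrow> (nat \<Rightarrow> nat) \<Rightarrow> (nat \<Rightarrow> nat) \<Rightarrow> bool" where
  "column_labelling lam d kap \<longleftrightarrow> kap 1 = 1 \<and>
     (\<forall>p\<in>{1..sum_list lam}. \<forall>q\<in>{1..sum_list lam}. d q = Suc (d p) \<longrightarrow>
        kap (d q) = kap (d p) \<and> blk lam p < blk lam q \<or> kap (d q) = Suc (kap (d p)))"

text \<open>The node with entry \<open>p\<close> in the filling by rows, and the set of all nodes.\<close>

definition node_at :: "nat list \<Rightarrow> (nat \<Rightarrow> nat) \<Rightarrow> (nat \<Rightarrow> nat) \<Rightarrow> nat \<Rightarrow> nat \<times> nat" where
  "node_at lam d kap p = (blk lam p, kap (d p))"

definition drawing :: "nat list \<Rightarrow> (nat \<Rightarrow> nat) \<Rightarrow> (nat \<Rightarrow> nat) \<Rightarrow> diag" where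
  "drawing lam d kap = node_at lam d kap ` {1..sum_list lam}"

lemma permutes_preimage:
  assumes "d permutes {1..n}" "1 \<le> v" "v \<le> n"
  obtains p where "p \<in> {1..n}" "d p = v"
proof -
  have "v \<in> d ` {1..n}" unfolding permutes_image[OF assms(1)] using assms by simp
  then show thesis using that by blast
qed

text \<open>Along the filling by columns, the nodes increase in the reading order by columns.\<close>

lemma column_labelling_lex:
  assumes d: "d permutes {1..n}" "n = sum_list lam" and kap: "column_labelling lam d kap"
    and p: "p \<in> {1..n}"
  shows "q \<in> {1..n} \<Longrightarrow> d p < d q \<Longrightarrow>
    kap (d p) < kap (d q) \<or> kap (d p) = kap (d q) \<and> blk lam p < blk lam q"
proof (induction "d q" arbitrary: q rule: less_induct)
  case less
  have "d q \<in> {1..n}" using permutes_in_image[OF d(1)] less.prems by blast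
  moreover have "d p \<in> {1..n}" using permutes_in_image[OF d(1)] p by blast
  ultimately have "1 \<le> d q - 1" "d q - 1 \<le> n" using less.prems by auto
  then obtain q' where q': "q' \<in> {1..n}" "d q' = d q - 1"
    using permutes_preimage[OF d(1)] by blast
  then have dq: "d q = Suc (d q')" using less.prems by simp
  have step: "kap (d q) = kap (d q') \<and> blk lam q' < blk lam q \<or> kap (d q) = Suc (kap (d q'))"
    using kap q'(1) less.prems(1) dq d(2) unfolding column_labelling_def by blast
  show ?case
  proof (cases "d q' = d p")
    case True
    then have "q' = p" by (rule injD[OF permutes_inj[OF d(1)]])
    then show ?thesis using step by auto
  next
    case False
    then have "d p < d q'" using q' less.prems by simp
    then show ?thesis using less.hyps[OF _ q'(1)] q' less.prems step by force
  qed
qed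

lemma column_labelling_mono:
  assumes d: "d permutes {1..n}" "n = sum_list lam" and kap: "column_labelling lam d kap"
    and pq: "p \<in> {1..n}" "q \<in> {1..n}" "d p \<le> d q"
  shows "kap (d p) \<le> kap (d q)"
  using column_labelling_lex[OF d kap pq(1,2)] pq(3) by (cases "d p = d q") auto

lemma column_labelling_image:
  assumes d: "d permutes {1..n}" "n = sum_list lam" and kap: "column_labelling lam d kap"
  shows "1 \<le> v \<Longrightarrow> v \<le> n \<Longrightarrow> kap ` {1..v} = {1..kap v}"
proof (induction v)
  case (Suc v)
  show ?case
  proof (cases "v = 0")
    case True
    then show ?thesis using kap by (simp add: column_labelling_def)
  next
    case False
    obtain p q where "p \<in> {1..n}" "d p = v" "q \<in> {1..n}" "d q = Suc v"
      using permutes_preimage[OF d(1), of v] permutes_preimage[OF d(1), of "Suc v"] False Suc.prems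
      by (metis Suc_leD less_one linorder_not_le)
    then have "kap (Suc v) = kap v \<or> kap (Suc v) = Suc (kap v)"
      using kap d(2) unfolding column_labelling_def by metis
    moreover have IH: "kap ` {1..v} = {1..kap v}" using Suc False by simp
    moreover have "{1..Suc v} = insert (Suc v) {1..v}" by auto
    moreover have "1 \<le> kap v" using IH False by (metis atLeastAtMost_iff imageI less_one linorder_not_le order_refl)
    ultimately show ?thesis by auto
  qed
qed simp

text \<open>What a column labelling draws is a diagram with the given data.\<close>

lemma drawing_diagram:
  assumes lam: "composition lam n" "lam \<noteq> []" and d: "block_increasing lam d"
    and kap: "column_labelling lam d kap"
  defines "D \<equiv> drawing lam d kap"
  shows "inj_on (node_at lam d kap) {1..n}"
    and "D \<in> diagrams_of lam" and "diag_perm D = d"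
    and "num_rows D = length lam" and "num_cols D = kap n" and "card D = n"
proof -
  let ?node = "node_at lam d kap"
  have n: "n = sum_list lam" using lam by (simp add: composition_def)
  have n1: "1 \<le> n" using lam by (cases lam) (auto simp: composition_def)
  have perm: "d permutes {1..n}" using d n by (simp add: block_increasing_def)
  have d_mem: "d p \<in> {1..n} \<longleftrightarrow> p \<in> {1..n}" for p using permutes_in_image[OF perm] by blast
  note lex = column_labelling_lex[OF perm n kap]
  have col: "col_order (?node p) (?node q) \<longleftrightarrow> d p \<le> d q" if "p \<in> {1..n}" "q \<in> {1..n}" for p q
  proof -
    have "p = q" if "d p = d q" using that by (rule injD[OF permutes_inj[OF perm]])
    then show ?thesis
      using lex[OF that] lex[OF that(2,1)] by (cases "d p" "d q" rule: linorder_cases)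
        (auto simp: col_order_def node_at_def)
  qed
  have row_less: "row_order (?node p) (?node q) \<and> \<not> row_order (?node q) (?node p)"
    if "p \<in> {1..n}" "q \<in> {1..n}" "p < q" for p q
  proof (cases "blk lam p = blk lam q")
    case True
    then have "d p < d q" using d that n by (simp add: block_increasing_def)
    then have "kap (d p) < kap (d q)" using lex[OF that(1,2)] True by simp
    then show ?thesis using True by (simp add: row_order_def node_at_def)
  next
    case False
    then have "blk lam p < blk lam q" using blk_mono[of p q lam] that by simp
    then show ?thesis by (simp add: row_order_def node_at_def)
  qed
  have row: "row_order (?node p) (?node q) \<longleftrightarrow> p \<le> q" if "p \<in> {1..n}" "q \<in> {1..n}" for p q
    using row_less[OF that] row_less[OF that(2,1)]
    by (cases p q rule: linorder_cases) (auto simp: row_order_def)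
  show inj: "inj_on ?node {1..n}"
    using row by (intro inj_onI) (metis antisym order_refl)
  have D: "D = ?node ` {1..n}" by (simp add: D_def drawing_def n)
  show card: "card D = n" unfolding D using inj by (simp add: card_image)
  have fin: "finite D" by (simp add: D)
  have rf: "row_filling D (?node q) = q" if "q \<in> {1..n}" for q
  proof -
    have "{y \<in> D. row_order y (?node q)} = ?node ` {1..q}"
      unfolding D using row that by auto
    moreover have "inj_on ?node {1..q}" using inj by (rule inj_on_subset) (use that in auto)
    ultimately show ?thesis unfolding row_filling_eq by (simp add: card_image)
  qed
  have cf: "col_filling D (?node q) = d q" if "q \<in> {1..n}" for q
  proof -
    have img: "{y \<in> D. col_order y (?node q)} = ?node ` {p \<in> {1..n}. d p \<le> d q}"
      unfolding D using col that by auto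
    have inj1: "inj_on ?node {p \<in> {1..n}. d p \<le> d q}" using inj by (rule inj_on_subset) auto
    have img2: "d ` {p \<in> {1..n}. d p \<le> d q} = {1..d q}"
    proof (intro equalityI subsetI)
      fix v assume v: "v \<in> {1..d q}"
      then have "v \<le> n" using d_mem[of q] that by auto
      then obtain p where "p \<in> {1..n}" "d p = v"
        using permutes_preimage[OF perm, of v] v by auto
      then show "v \<in> d ` {p \<in> {1..n}. d p \<le> d q}" using v by auto
    next
      fix v assume "v \<in> d ` {p \<in> {1..n}. d p \<le> d q}"
      then show "v \<in> {1..d q}" using d_mem by auto
    qed
    have inj2: "inj_on d {p \<in> {1..n}. d p \<le> d q}"
      using permutes_inj[OF perm] by (rule inj_on_subset) simp
    show ?thesis
      unfolding col_filling_eq img using card_image[OF inj1] card_image[OF inj2] unfolding img2 by simp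
  qed
  show "diag_perm D = d"
  proof
    fix i
    show "diag_perm D i = d i"
    proof (cases "i \<in> {1..n}")
      case True
      then have "inv_into D (row_filling D) i = ?node i"
        using row_filling_bij(1)[OF fin] rf[OF True] D
        by (intro inv_into_f_eq) (auto simp: bij_betw_def)
      then show ?thesis using cf[OF True] True by (simp add: diag_perm_def card)
    next
      case False
      then show ?thesis using permutes_not_in[OF perm False] by (auto simp: diag_perm_def card)
    qed
  qed
  have block: "card {p \<in> {1..n}. blk lam p = a} = lam ! (a - 1)" "0 < lam ! (a - 1)"
    if "a \<in> {1..length lam}" for a
    using card_blk_eq[of "a - 1" lam] that n lam(1) by (auto simp: composition_def)
  have fst: "fst ` D = {1..length lam}"
  proof (intro equalityI subsetI)
    fix a assume "a \<in> fst ` D"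
    then obtain p where "p \<in> {1..n}" "a = blk lam p" by (auto simp: D node_at_def)
    then show "a \<in> {1..length lam}" using blk_ge_1[of lam p] blk_le_length[of p lam] n by simp
  next
    fix a assume "a \<in> {1..length lam}"
    then have "card {p \<in> {1..n}. blk lam p = a} \<noteq> 0" using block[of a] by simp
    then have "{p \<in> {1..n}. blk lam p = a} \<noteq> {}" by (metis card.empty)
    then obtain p where p: "p \<in> {1..n}" "blk lam p = a" by blast
    then have "a = fst (?node p)" by (simp add: node_at_def)
    moreover have "?node p \<in> D" unfolding D using p(1) by (rule imageI)
    ultimately show "a \<in> fst ` D" by (rule image_eqI)
  qed
  have "snd ` D = kap ` d ` {1..n}" by (simp add: D image_image node_at_def)
  also have "\<dots> = kap ` {1..n}" by (simp only: permutes_image[OF perm])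
  also have "\<dots> = {1..kap n}" using column_labelling_image[OF perm n kap n1] by simp
  finally have snd: "snd ` D = {1..kap n}" .
  show rows: "num_rows D = length lam" and cols: "num_cols D = kap n"
    by (simp_all add: num_rows_def num_cols_def fst snd)
  have "diagram D"
    using fin fst snd rows cols n1 by (auto simp: diagram_def D)
  moreover have "card {b. (a, b) \<in> D} = lam ! (a - 1)" if a: "a \<in> {1..length lam}" for a
  proof -
    have "Pair a ` {b. (a, b) \<in> D} = ?node ` {p \<in> {1..n}. blk lam p = a}"
      by (auto simp: D node_at_def)
    moreover have "card (Pair a ` {b. (a, b) \<in> D}) = card {b. (a, b) \<in> D}"
      by (intro card_image) (simp add: inj_on_def)
    ultimately have "card {b. (a, b) \<in> D} = card (?node ` {p \<in> {1..n}. blk lam p = a})"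
      by simp
    also have "\<dots> = card {p \<in> {1..n}. blk lam p = a}"
      by (intro card_image inj_on_subset[OF inj]) auto
    finally show ?thesis using block[OF a] by simp
  qed
  then have "row_comp D = lam"
    unfolding row_comp_def rows by (intro nth_equalityI) (auto simp del: upt_Suc)
  ultimately show "D \<in> diagrams_of lam" by (simp add: diagrams_of_def)
qed

lemma diagrams_of_rows:
  assumes E: "E \<in> diagrams_of lam"
  shows "finite E" "fst ` E = {1..length lam}" "num_rows E = length lam" "snd ` E = {1..num_cols E}"
    "E \<noteq> {}"
    and "\<And>a. a \<in> {1..length lam} \<Longrightarrow> card {x \<in> E. fst x = a} = lam ! (a - 1)"
    and "\<And>a. a \<le> length lam \<Longrightarrow> card {x \<in> E. fst x \<le> a} = sum_list (take a lam)"
    and "card E = sum_list lam"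
proof -
  show E': "finite E" "num_rows E = length lam" "snd ` E = {1..num_cols E}" "E \<noteq> {}"
    using E by (auto simp: diagrams_of_def diagram_def row_comp_def simp del: upt_Suc)
  then show fst: "fst ` E = {1..length lam}" using E by (auto simp: diagrams_of_def diagram_def)
  show row: "card {x \<in> E. fst x = a} = lam ! (a - 1)" if a: "a \<in> {1..length lam}" for a
  proof -
    have "{x \<in> E. fst x = a} = Pair a ` {b. (a, b) \<in> E}" by force
    then have "card {x \<in> E. fst x = a} = card {b. (a, b) \<in> E}" by (simp add: card_image inj_on_def)
    also have "\<dots> = row_comp E ! (a - 1)"
    proof -
      have "a - 1 < length [1..<Suc (num_rows E)]" "[1..<Suc (num_rows E)] ! (a - 1) = a"
        using a E'(2) by (auto simp del: upt_Suc simp: less_diff_conv)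
      then show ?thesis unfolding row_comp_def by (simp only: nth_map)
    qed
    finally show ?thesis using E by (simp add: diagrams_of_def)
  qed
  show upto: "card {x \<in> E. fst x \<le> a} = sum_list (take a lam)" if "a \<le> length lam" for a
    using that
  proof (induction a)
    case 0
    have "{x \<in> E. fst x \<le> 0} = {}" using fst by force
    then show ?case by (simp only: card.empty) simp
  next
    case (Suc a)
    have "{x \<in> E. fst x \<le> Suc a} = {x \<in> E. fst x \<le> a} \<union> {x \<in> E. fst x = Suc a}" by auto
    then have "card {x \<in> E. fst x \<le> Suc a} = card {x \<in> E. fst x \<le> a} + card {x \<in> E. fst x = Suc a}"
      using E'(1) by (simp add: card_Un_disjoint disjoint_iff)
    then show ?case using Suc row[of "Suc a"] by (simp add: take_Suc_conv_app_nth)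
  qed
  have "{x \<in> E. fst x \<le> length lam} = E" using fst by force
  then show "card E = sum_list lam" using upto[of "length lam"] by simp
qed

text \<open>Conversely, every diagram with the given data is drawn by a column labelling.\<close>

lemma diagram_is_drawing:
  assumes lam: "n = sum_list lam" and d: "d permutes {1..n}"
    and E: "E \<in> diagrams_of lam" "diag_perm E = d"
  obtains kap where "column_labelling lam d kap" "E = drawing lam d kap"
proof -
  note E' = diagrams_of_rows[OF E(1)]
  let ?rf = "row_filling E" and ?cf = "col_filling E"
  have card: "card E = n" using E' lam by simp
  note rf = row_filling_bij[OF E'(1)] and cf = col_filling_bij[OF E'(1)]
  have rf_inj: "x = y" if "x \<in> E" "y \<in> E" "?rf x = ?rf y" for x y
    using rf(1) that by (meson bij_betw_def inj_onD)
  have cf_inj: "x = y" if "x \<in> E" "y \<in> E" "?cf x = ?cf y" for x y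
    using cf(1) that by (meson bij_betw_def inj_onD)
  have rf_mem: "?rf x \<in> {1..n}" if "x \<in> E" for x using rf(1) that card by (auto simp: bij_betw_def)
  have cf_mem: "?cf x \<in> {1..n}" if "x \<in> E" for x using cf(1) that card by (auto simp: bij_betw_def)
  have rf_ex: "\<exists>x\<in>E. ?rf x = p" if "p \<in> {1..n}" for p
  proof -
    have "p \<in> ?rf ` E" using rf(1) that card by (simp add: bij_betw_def)
    then show ?thesis by blast
  qed
  have d_rf: "d (?rf x) = ?cf x" if "x \<in> E" for x
  proof -
    have "inv_into E ?rf (?rf x) = x" using rf(1) that by (simp add: bij_betw_def)
    then show ?thesis using rf_mem[OF that] card unfolding E(2)[symmetric] by (simp add: diag_perm_def)
  qed
  have blk: "blk lam (?rf x) = fst x" if x: "x \<in> E" for x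
  proof -
    have a: "fst x \<in> {1..length lam}" using E'(2) x by blast
    have "{y \<in> E. fst y \<le> fst x - 1} \<subset> {y \<in> E. row_order y x}"
      using x a by (auto simp: row_order_def)
    then have "sum_list (take (fst x - 1) lam) < ?rf x"
      using E'(1) E'(7)[of "fst x - 1"] a unfolding row_filling_eq by (metis (no_types, lifting)
        psubset_card_mono atLeastAtMost_iff diff_le_self finite_Collect_conjI finite_subset order_trans mem_Collect_eq subsetI)
    moreover have "{y \<in> E. row_order y x} \<subseteq> {y \<in> E. fst y \<le> fst x}"
      by (auto simp: row_order_def)
    then have "?rf x \<le> card {y \<in> E. fst y \<le> fst x}"
      using E'(1) unfolding row_filling_eq by (intro card_mono) auto
    then have "?rf x \<le> sum_list (take (fst x) lam)" using E'(7)[of "fst x"] a by simp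
    ultimately show ?thesis
      using blk_eq_iff[of "?rf x" lam "fst x - 1"] rf_mem[OF x] a lam
      by (cases "fst x") simp_all
  qed
  define kap where "kap v = snd (inv_into E ?cf v)" for v
  have kap: "kap (?cf x) = snd x" if "x \<in> E" for x
  proof -
    have "inv_into E ?cf (?cf x) = x" using cf(1) that by (simp add: bij_betw_def)
    then show ?thesis by (simp add: kap_def)
  qed
  have node: "node_at lam d kap (?rf x) = x" if "x \<in> E" for x
    using that by (simp add: node_at_def d_rf kap blk)
  have "kap 1 = 1"
  proof -
    have "1 \<le> num_cols E" using E'(4,5) by fastforce
    then have "1 \<in> snd ` E" using E'(4) by simp
    then obtain y where y: "y \<in> E" "snd y = 1" by auto
    have "1 \<in> {1..n}" using cf_mem[OF y(1)] by simp
    then obtain x where x: "x \<in> E" "?cf x = 1"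
      using cf(1) card by (metis bij_betw_imp_surj_on imageE)
    then have "col_order x y" using cf(2)[OF x(1) y(1)] cf_mem[OF y(1)] by simp
    then have "snd x \<le> 1" using y by (auto simp: col_order_def)
    moreover have "snd x \<in> {1..num_cols E}" using x E'(4) by blast
    ultimately show ?thesis using kap[OF x(1)] x by simp
  qed
  moreover have "kap (d q) = kap (d p) \<and> blk lam p < blk lam q \<or> kap (d q) = Suc (kap (d p))"
    if pq: "p \<in> {1..n}" "q \<in> {1..n}" "d q = Suc (d p)" for p q
  proof -
    obtain x y where x: "x \<in> E" "?rf x = p" and y: "y \<in> E" "?rf y = q"
      using rf_ex pq by meson
    have xy: "?cf y = Suc (?cf x)" using pq d_rf x y by metis
    then have le: "col_order x y" "x \<noteq> y" using cf(2)[OF x(1) y(1)] by auto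
    have vals: "kap (d p) = snd x" "kap (d q) = snd y" "blk lam p = fst x" "blk lam q = fst y"
      using x y d_rf kap blk by metis+
    show ?thesis
    proof (cases "snd x = snd y")
      case True
      then show ?thesis using le vals by (auto simp: col_order_def prod_eq_iff)
    next
      case False
      then have less: "snd x < snd y" using le by (auto simp: col_order_def)
      have "snd y = Suc (snd x)"
      proof (rule ccontr)
        assume "snd y \<noteq> Suc (snd x)"
        then have lt: "Suc (snd x) < snd y" using less by simp
        have "snd y \<in> {1..num_cols E}" using y E'(4) by blast
        then have "Suc (snd x) \<in> snd ` E" using lt E'(4) by simp
        then obtain z where z: "z \<in> E" "snd z = Suc (snd x)" by auto
        have "\<not> col_order z x" "\<not> col_order y z" using z lt by (auto simp: col_order_def)
        then have "?cf x < ?cf z" "?cf z < ?cf y"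
          using cf(2)[OF z(1) x(1)] cf(2)[OF y(1) z(1)] by auto
        then show False using xy by simp
      qed
      then show ?thesis using vals by simp
    qed
  qed
  ultimately have "column_labelling lam d kap" by (simp add: column_labelling_def lam)
  moreover have "E = drawing lam d kap"
  proof (intro equalityI subsetI)
    fix x assume x: "x \<in> E"
    show "x \<in> drawing lam d kap"
      unfolding drawing_def lam[symmetric] using node[OF x] rf_mem[OF x] by (metis imageI)
  next
    fix x assume "x \<in> drawing lam d kap"
    then obtain p where "p \<in> {1..n}" "x = node_at lam d kap p" by (auto simp: drawing_def lam)
    then show "x \<in> E" using rf_ex[of p] node by auto
  qed
  ultimately show thesis using that by blast
qed

text \<open>
  The smallest column labelling is constant at every step that permits it. All others exceed it
  by a function that never decreases, so that the last column decides.
\<close>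

primrec min_labelling :: "nat list \<Rightarrow> (nat \<Rightarrow> nat) \<Rightarrow> nat \<Rightarrow> nat" where
  "min_labelling lam d 0 = 0"
| "min_labelling lam d (Suc v) =
     (if v \<noteq> 0 \<and> blk lam (inv_into UNIV d v) < blk lam (inv_into UNIV d (Suc v))
      then min_labelling lam d v else Suc (min_labelling lam d v))"

lemma min_labelling_step:
  assumes "d permutes {1..n}" "p \<in> {1..n}" "d q = Suc (d p)"
  shows "min_labelling lam d (d q) =
    (if blk lam p < blk lam q then min_labelling lam d (d p) else Suc (min_labelling lam d (d p)))"
proof -
  have "inv_into UNIV d (d p) = p" for p using permutes_inverses(2)[OF assms(1)] .
  moreover have "d p \<noteq> 0" using permutes_in_image[OF assms(1), of p] assms(2) by simp
  ultimately show ?thesis unfolding assms(3) using assms(3) by (metis min_labelling.simps(2))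
qed

lemma column_labelling_min:
  "d permutes {1..sum_list lam} \<Longrightarrow> column_labelling lam d (min_labelling lam d)"
  using min_labelling_step[of d "sum_list lam" _ _ lam] unfolding column_labelling_def
  by (metis One_nat_def min_labelling.simps)

lemma min_labelling_le:
  assumes d: "d permutes {1..n}" "n = sum_list lam" and kap: "column_labelling lam d kap"
    and u: "1 \<le> u"
  shows "u \<le> v \<Longrightarrow> v \<le> n \<Longrightarrow> kap u + min_labelling lam d v \<le> kap v + min_labelling lam d u"
proof (induction v rule: dec_induct)
  case (step v)
  obtain p where p: "p \<in> {1..n}" "d p = v"
    using permutes_preimage[OF d(1), of v] u step by auto
  obtain q where q: "q \<in> {1..n}" "d q = Suc v"
    using permutes_preimage[OF d(1), of "Suc v"] step by auto
  have "kap (d q) = kap (d p) \<and> blk lam p < blk lam q \<or> kap (d q) = Suc (kap (d p))"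
    using kap p q d(2) unfolding column_labelling_def by metis
  then have "min_labelling lam d (Suc v) - min_labelling lam d v \<le> kap (Suc v) - kap v"
    "kap v \<le> kap (Suc v)"
    using min_labelling_step[OF d(1) p(1), of q lam] p q by auto
  then show ?case using step by simp
qed simp

text \<open>The diagram with the smallest number of columns exists and is unique.\<close>

lemma min_diagram_eq:
  assumes lam: "composition lam n" "lam \<noteq> []" and d: "block_increasing lam d"
  shows "min_diagram d lam = drawing lam d (min_labelling lam d)"
proof -
  have n: "n = sum_list lam" using lam by (simp add: composition_def)
  have n1: "1 \<le> n" using lam by (cases lam) (auto simp: composition_def)
  have perm: "d permutes {1..n}" using d n by (simp add: block_increasing_def)
  let ?k = "min_labelling lam d"
  have k: "column_labelling lam d ?k" using perm n by (simp add: column_labelling_min)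
  note D = drawing_diagram[OF lam d]
  have le: "num_cols (drawing lam d ?k) \<le> num_cols (drawing lam d kap)"
    and eq: "num_cols (drawing lam d kap) = num_cols (drawing lam d ?k) \<Longrightarrow>
      drawing lam d kap = drawing lam d ?k"
    if kap: "column_labelling lam d kap" for kap
  proof -
    have 1: "kap 1 = 1" using kap by (simp add: column_labelling_def)
    have k1: "?k 1 = 1" by simp
    note le = min_labelling_le[OF perm n kap]
    show "num_cols (drawing lam d ?k) \<le> num_cols (drawing lam d kap)"
      using le[of 1 n] n1 1 k1 D(5)[OF kap] D(5)[OF k] by simp
    assume "num_cols (drawing lam d kap) = num_cols (drawing lam d ?k)"
    then have n_eq: "kap n = ?k n" using D(5)[OF kap] D(5)[OF k] by simp
    have "kap (d p) = ?k (d p)" if "p \<in> {1..n}" for p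
    proof -
      have "d p \<in> {1..n}" using permutes_in_image[OF perm] that by blast
      then show ?thesis using le[of 1 "d p"] le[of "d p" n] n_eq 1 k1 by simp
    qed
    then show "drawing lam d kap = drawing lam d ?k"
      unfolding drawing_def n[symmetric] by (intro image_cong) (auto simp: node_at_def)
  qed
  show ?thesis unfolding min_diagram_def
  proof (rule the_equality)
    show "is_arg_min num_cols (\<lambda>E. E \<in> diagrams_of lam \<and> diag_perm E = d) (drawing lam d ?k)"
      unfolding is_arg_min_def using D(2,3)[OF k] le diagram_is_drawing[OF n perm]
      by (metis linorder_not_le)
  next
    fix E assume E: "is_arg_min num_cols (\<lambda>E. E \<in> diagrams_of lam \<and> diag_perm E = d) E"
    then obtain kap where kap: "column_labelling lam d kap" "E = drawing lam d kap"
      using diagram_is_drawing[OF n perm, of E] by (auto simp: is_arg_min_def)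
    have "\<not> num_cols (drawing lam d ?k) < num_cols E"
      using E D(2,3)[OF k] by (auto simp: is_arg_min_def)
    then show "E = drawing lam d ?k" using le[OF kap(1)] eq[OF kap(1)] kap(2) by simp
  qed
qed

text \<open>
  Appending a node below the only node in the last row: the new node is the successor of that one
  in the reading order by columns.
\<close>

lemma append_node_eq_drawing:
  assumes lam: "composition lam n" "lam = mu @ [1]" and d: "block_increasing lam d"
    and kap: "column_labelling lam d kap"
  obtains kap' where "column_labelling (lam @ [1]) (append_next n d) kap'"
    "append_node (drawing lam d kap) (kap (d n)) = drawing (lam @ [1]) (append_next n d) kap'"
proof -
  have n: "n = sum_list lam" using lam by (simp add: composition_def)
  have n1: "n \<in> {1..n}" using n lam(2) by simp
  have perm: "d permutes {1..n}" using d n by (simp add: block_increasing_def)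
  have dn: "d n \<in> {1..n}" using permutes_in_image[OF perm] n1 by blast
  have inj: "p = q" if "d p = d q" for p q using that by (rule injD[OF permutes_inj[OF perm]])
  define kap' where "kap' v = (if v \<le> d n then kap v else kap (v - 1))" for v
  have old: "kap' (append_next n d p) = kap (d p)" if "p \<le> n" for p
    using that by (auto simp: kap'_def append_next_def append_value_def shift_from_def)
  have new: "append_next n d (Suc n) = Suc (d n)" "kap' (Suc (d n)) = kap (d n)"
    by (auto simp: kap'_def append_next_def append_value_def)
  have blk_old: "blk (lam @ [1]) p = blk lam p" "blk lam p \<le> length lam" if "p \<in> {1..n}" for p
    using that n blk_le_length[of p lam] by (auto simp: blk_snoc)
  have blk_new: "blk (lam @ [1]) (Suc n) = Suc (length lam)" using n by (simp add: blk_snoc)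
  have blk_n: "blk lam n = length lam" unfolding lam(2) using n lam(2) by (simp add: blk_snoc)
  have step: "kap (d q) = kap (d p) \<and> blk lam p < blk lam q \<or> kap (d q) = Suc (kap (d p))"
    if "p \<in> {1..n}" "q \<in> {1..n}" "d q = Suc (d p)" for p q
    using kap that n by (simp add: column_labelling_def)
  have "kap' (append_next n d q) = kap' (append_next n d p) \<and> blk (lam @ [1]) p < blk (lam @ [1]) q \<or>
      kap' (append_next n d q) = Suc (kap' (append_next n d p))"
    if pq: "p \<in> {1..Suc n}" "q \<in> {1..Suc n}" "append_next n d q = Suc (append_next n d p)" for p q
  proof -
    consider "p \<in> {1..n}" "q \<in> {1..n}" | "p \<in> {1..n}" "q = Suc n" | "p = Suc n" "q \<in> {1..n}"
      | "p = Suc n" "q = Suc n"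
      using pq by force
    then show ?thesis
    proof cases
      case 1
      then have "d q = Suc (d p)"
        using pq(3) by (auto simp: append_next_def append_value_def shift_from_def split: if_splits)
      from step[OF 1 this] show ?thesis
        unfolding blk_old(1)[OF 1(1)] blk_old(1)[OF 1(2)] using 1 by (simp add: old)
    next
      case 2
      then have "d p = d n"
        using pq(3) by (auto simp: append_next_def append_value_def shift_from_def split: if_splits)
      then have "p = n" by (rule inj)
      then show ?thesis
        unfolding 2(2) blk_new using blk_n blk_old(1)[OF n1] by (simp add: old new)
    next
      case 3
      then have "d q = Suc (d n)"
        using pq(3) by (auto simp: append_next_def append_value_def shift_from_def split: if_splits)
      \<comment> \<open>The node of \<open>n\<close> lies in the last row, so the next column begins behind it.\<close>
      then have "kap (d q) = Suc (kap (d n))"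
        using step[OF n1 3(2)] blk_n blk_old(2)[OF 3(2)] by simp
      then show ?thesis using 3 by (simp add: old new)
    next
      case 4
      then show ?thesis using pq(3) by simp
    qed
  qed
  moreover have "kap' 1 = 1" using kap dn by (simp add: kap'_def column_labelling_def)
  ultimately have lab: "column_labelling (lam @ [1]) (append_next n d) kap'"
    unfolding column_labelling_def using n by simp
  have "drawing (lam @ [1]) (append_next n d) kap' = node_at (lam @ [1]) (append_next n d) kap' ` insert (Suc n) {1..n}"
    unfolding drawing_def using n by (intro arg_cong[where f = "image _"]) auto
  also have "\<dots> = insert (Suc (length lam), kap (d n)) (drawing lam d kap)"
  proof -
    have "node_at (lam @ [1]) (append_next n d) kap' ` {1..n} = node_at lam d kap ` {1..n}"
    proof (intro image_cong refl)
      fix p assume p: "p \<in> {1..n}"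
      then show "node_at (lam @ [1]) (append_next n d) kap' p = node_at lam d kap p"
        unfolding node_at_def blk_old(1)[OF p] by (simp add: old)
    qed
    moreover have "node_at (lam @ [1]) (append_next n d) kap' (Suc n) = (Suc (length lam), kap (d n))"
      unfolding node_at_def blk_new by (simp add: new)
    ultimately show ?thesis unfolding drawing_def n[symmetric] by (simp only: image_insert)
  qed
  also have "\<dots> = append_node (drawing lam d kap) (kap (d n))"
    using drawing_diagram(4)[OF lam(1) _ d kap] lam(2) by (simp add: append_node_def)
  finally show thesis using that lab by simp
qed

section \<open>Paths and admissibility\<close>

lemma sum_list_take_conjugate:
  assumes "lam \<noteq> []" "k \<le> Max (set lam)"
  shows "sum_list (take k (conjugate lam)) = (\<Sum>m\<leftarrow>lam. min k m)"
  using assms(2)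
proof (induction k)
  case (Suc k)
  have "conjugate lam ! k = length (filter (\<lambda>m. Suc k \<le> m) lam)"
    using Suc.prems by (simp add: conjugate_def length_filter_conv_card del: upt_Suc)
  moreover have "(\<Sum>m\<leftarrow>lam. min (Suc k) m) = (\<Sum>m\<leftarrow>lam. min k m) + length (filter (\<lambda>m. Suc k \<le> m) lam)"
    by (induction lam) auto
  moreover have "k < length (conjugate lam)" using Suc.prems by (simp add: conjugate_def)
  ultimately show ?case using Suc by (simp add: take_Suc_conv_app_nth)
qed simp

lemma length_conjugate: "length (conjugate lam) = Max (set lam)"
  by (simp add: conjugate_def)

lemma is_partition_conjugate:
  assumes lam: "composition lam n" "lam \<noteq> []"
  shows "is_partition (conjugate lam) n"
proof -
  have "sum_list (conjugate lam) = (\<Sum>m\<leftarrow>lam. min (Max (set lam)) m)"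
    using sum_list_take_conjugate[OF lam(2), of "Max (set lam)"] length_conjugate[of lam] by simp
  also have "\<dots> = sum_list lam" by (simp add: map_idI min_absorb2)
  finally have "sum_list (conjugate lam) = n" using lam(1) by (simp add: composition_def)
  moreover have "0 < card {j. j < length lam \<and> i \<le> lam ! j}" if "i \<le> Max (set lam)" for i
  proof -
    have "Max (set lam) \<in> set lam" using lam(2) by simp
    then obtain j where "j < length lam" "lam ! j = Max (set lam)" by (auto simp: in_set_conv_nth)
    then have "j \<in> {j. j < length lam \<and> i \<le> lam ! j}" using that by simp
    then show ?thesis by (subst card_gt_0_iff) auto
  qed
  moreover have "sorted_wrt (\<ge>) (conjugate lam)"
    unfolding conjugate_def sorted_wrt_map
    by (rule sorted_wrt_mono_rel[OF _ sorted_wrt_upt]) (auto intro!: card_mono)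
  ultimately show ?thesis
    by (auto simp: is_partition_def composition_def conjugate_def less_Suc_eq_le)
qed

lemma sum_list_eq_sum_rows: "(\<Sum>m\<leftarrow>lam. f m) = (\<Sum>a\<in>{1..length lam}. f (lam ! (a - 1)))"
proof -
  have "(\<Sum>m\<leftarrow>lam. f m) = (\<Sum>i\<in>{0..<length lam}. f (lam ! i))"
    by (simp add: sum_list_sum_nth)
  also have "\<dots> = (\<Sum>a\<in>{1..length lam}. f (lam ! (a - 1)))"
    by (rule sum.reindex_bij_witness[of _ "\<lambda>a. a - 1" Suc]) auto
  finally show ?thesis .
qed

text \<open>Since a path meets each row at most once, \<open>k\<close> disjoint paths have a bounded total length.\<close>

lemma disjoint_sets_bound:
  assumes E: "E \<in> diagrams_of lam" and "finite I"
    and C: "\<And>i. i \<in> I \<Longrightarrow> C i \<subseteq> E" "\<And>i. i \<in> I \<Longrightarrow> inj_on fst (C i)"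
    and disj: "\<And>i j. i \<in> I \<Longrightarrow> j \<in> I \<Longrightarrow> i \<noteq> j \<Longrightarrow> C i \<inter> C j = {}"
  shows "(\<Sum>i\<in>I. card (C i)) \<le> (\<Sum>m\<leftarrow>lam. min (card I) m)"
proof -
  note E' = diagrams_of_rows[OF E]
  have finC: "finite (C i)" if "i \<in> I" for i using C(1)[OF that] E'(1) by (rule finite_subset)
  let ?U = "\<Union>i\<in>I. C i" and ?row = "\<lambda>a. {x \<in> (\<Union>i\<in>I. C i). fst x = a}"
  have "(\<Sum>i\<in>I. card (C i)) = card ?U"
    using \<open>finite I\<close> finC disj by (intro card_UN_disjoint[symmetric]) blast+
  also have "?U = (\<Union>a\<in>{1..length lam}. ?row a)"
  proof (intro equalityI subsetI)
    fix x assume x: "x \<in> ?U"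
    then have "fst x \<in> {1..length lam}" using C(1) unfolding E'(2)[symmetric] by blast
    then show "x \<in> (\<Union>a\<in>{1..length lam}. ?row a)" using x by blast
  qed blast
  also have "card \<dots> \<le> (\<Sum>a\<in>{1..length lam}. card (?row a))"
    by (intro card_UN_le) simp
  also have "\<dots> \<le> (\<Sum>a\<in>{1..length lam}. min (card I) (lam ! (a - 1)))"
  proof (intro sum_mono min.boundedI)
    fix a assume a: "a \<in> {1..length lam}"
    have "card (?row a) \<le> card {x \<in> E. fst x = a}"
    proof (rule card_mono)
      show "?row a \<subseteq> {x \<in> E. fst x = a}" using C(1) by blast
    qed (use E'(1) in simp)
    then show "card (?row a) \<le> lam ! (a - 1)" using E'(6)[OF a] by simp
    have "?row a = (\<Union>i\<in>I. {x \<in> C i. fst x = a})" by auto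
    then have "card (?row a) \<le> (\<Sum>i\<in>I. card {x \<in> C i. fst x = a})"
      using card_UN_le[OF \<open>finite I\<close>, of "\<lambda>i. {x \<in> C i. fst x = a}"] by simp
    also have "\<dots> \<le> (\<Sum>i\<in>I. 1)"
    proof (rule sum_mono)
      fix i assume i: "i \<in> I"
      have "x = y" if "x \<in> {x \<in> C i. fst x = a}" "y \<in> {x \<in> C i. fst x = a}" for x y
        using C(2)[OF i] that by (auto simp: inj_on_def)
      then show "card {x \<in> C i. fst x = a} \<le> 1"
        using finC[OF i] by (simp add: card_le_Suc0_iff_eq)
    qed
    finally show "card (?row a) \<le> card I" by simp
  qed
  finally show ?thesis by (simp add: sum_list_eq_sum_rows)
qed

lemma is_path_iff_sorted_wrt:
  "is_path D p \<longleftrightarrow> p \<noteq> [] \<and> set p \<subseteq> D \<and> sorted_wrt (\<lambda>x y. fst x < fst y \<and> snd x \<le> snd y) p"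
proof -
  have "transp (\<lambda>x y :: nat \<times> nat. fst x < fst y \<and> snd x \<le> snd y)"
    by (auto simp: transp_def)
  then show ?thesis
    unfolding is_path_def by (simp add: successively_conv_sorted_wrt[symmetric] case_prod_beta)
qed

lemma path_distinct_fst:
  assumes "is_path D p"
  shows "distinct (map fst p)"
proof -
  have "sorted_wrt (<) (map fst p)"
    using assms unfolding is_path_iff_sorted_wrt sorted_wrt_map
    by (auto elim: sorted_wrt_mono_rel[rotated])
  then show ?thesis using strict_sorted_iff by blast
qed

lemma k_path_length_le:
  assumes "E \<in> diagrams_of lam" "m \<in> k_path_lengths E k"
  shows "m \<le> (\<Sum>x\<leftarrow>lam. min k x)"
proof -
  obtain ps where ps: "is_k_path E k ps" "m = sum_list (map length ps)"
    using assms(2) by (auto simp: k_path_lengths_def)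
  then have len: "length ps = k" and path: "\<And>i. i < k \<Longrightarrow> is_path E (ps ! i)"
    by (auto simp: is_k_path_def)
  have dist: "distinct (map fst (ps ! i))" if "i < k" for i
    using path_distinct_fst[OF path[OF that]] .
  have "m = (\<Sum>i<k. length (ps ! i))"
    using ps(2) len by (simp add: sum_list_sum_nth atLeast0LessThan)
  also have "\<dots> = (\<Sum>i<k. card (set (ps ! i)))"
    using dist by (intro sum.cong) (auto simp: distinct_map distinct_card)
  also have "\<dots> \<le> (\<Sum>x\<leftarrow>lam. min (card {..<k}) x)"
    using dist path ps(1)
    by (intro disjoint_sets_bound[OF assms(1)]) (auto simp: is_path_def is_k_path_def distinct_map)
  finally show ?thesis by simp
qed

text \<open>
  The increasing subsequences of the word with decreasing blocks give paths: they meet each block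
  at most once, because the word decreases along the blocks.
\<close>

lemma k_path_exists:
  assumes lam: "composition lam n" "lam \<noteq> []" and d: "d \<in> Z_set lam"
    and kap: "column_labelling lam d kap" and k: "k \<le> Max (set lam)"
  shows "(\<Sum>m\<leftarrow>lam. min k m) \<in> k_path_lengths (drawing lam d kap) k"
proof -
  have n: "n = sum_list lam" using lam by (simp add: composition_def)
  have d': "block_increasing lam d" "recording_tableau n (d \<circ> brev lam) = recording_tableau n (brev lam)"
    using d by (auto simp: Z_set_eq[OF lam(1)])
  have perm: "d permutes {1..n}" using d'(1) n by (simp add: block_increasing_def)
  let ?D = "drawing lam d kap" and ?b = "brev lam"
  note D = drawing_diagram[OF lam d'(1) kap]
  have "map length (insertion_tableau n (d \<circ> ?b)) = map length (insertion_tableau n ?b)"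
    using d'(2) by (simp add: shape_insertion_recording)
  then have shape: "sum_list (take k (map length (insertion_tableau n (d \<circ> ?b)))) = (\<Sum>m\<leftarrow>lam. min k m)"
    using shape_brev n by simp
  obtain f where f: "\<And>p q. p \<in> {1..n} \<Longrightarrow> q \<in> {1..n} \<Longrightarrow> p < q \<Longrightarrow> f p = f q \<Longrightarrow> f p < k \<Longrightarrow>
      (d \<circ> ?b) p \<le> (d \<circ> ?b) q" "(\<Sum>m\<leftarrow>lam. min k m) \<le> card {p \<in> {1..n}. f p < k}"
    using greene_lower_bound[of n k "d \<circ> ?b"] unfolding shape by blast
  have b_mem: "?b p \<in> {1..n}" if "p \<in> {1..n}" for p using brev_in_block(1)[of p lam] that n by simp
  define x where "x p = node_at lam d kap (?b p)" for p
  define path where "path i = map x (filter (\<lambda>p. f p = i) [1..<Suc n])" for i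
  have x_mem: "x p \<in> ?D" if "p \<in> {1..n}" for p
    unfolding x_def drawing_def n[symmetric] using b_mem[OF that] by (rule imageI)
  have x_inj: "inj_on x {1..n}"
    using D(1) b_mem permutes_inj[OF brev_permutes[of lam]]
    by (intro inj_onI) (metis inj_onD injD x_def)
  have x_less: "fst (x p) < fst (x q) \<and> snd (x p) \<le> snd (x q)"
    if pq: "p \<in> {1..n}" "q \<in> {1..n}" "p < q" "f p = f q" "f p < k" for p q
  proof -
    have le: "d (?b p) \<le> d (?b q)" using f(1)[OF pq] by simp
    have b: "?b p \<in> {1..n}" "?b q \<in> {1..n}" "blk lam (?b p) = blk lam p" "blk lam (?b q) = blk lam q"
      using b_mem pq brev_in_block(2) n by auto
    have "blk lam p \<noteq> blk lam q"
    proof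
      assume eq: "blk lam p = blk lam q"
      then have "?b q < ?b p" using pq n by (intro brev_decreasing) auto
      then have "d (?b q) < d (?b p)" using d'(1) b eq n by (simp add: block_increasing_def)
      then show False using le by simp
    qed
    then have "blk lam p < blk lam q" using blk_mono[of p q lam] pq by simp
    moreover have "kap (d (?b p)) \<le> kap (d (?b q))"
      using column_labelling_mono[OF perm n kap b(1,2) le] .
    ultimately show ?thesis using b by (simp add: x_def node_at_def)
  qed
  have set_path: "set (path i) = x ` {p \<in> {1..n}. f p = i}" for i
    unfolding path_def by auto
  have sorted: "sorted_wrt (\<lambda>x y. fst x < fst y \<and> snd x \<le> snd y) (path i)" if "i < k" for i
    unfolding path_def sorted_wrt_map
  proof (rule sorted_wrt_mono_rel)
    show "sorted_wrt (<) (filter (\<lambda>p. f p = i) [1..<Suc n])"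
      by (intro sorted_wrt_filter sorted_wrt_upt)
  qed (use x_less that in \<open>auto simp del: upt_Suc\<close>)
  have len: "length (path i) = card (set (path i))" "inj_on fst (set (path i))" if "i < k" for i
  proof -
    have "sorted_wrt (<) (map fst (path i))"
      using sorted[OF that] unfolding sorted_wrt_map by (auto elim: sorted_wrt_mono_rel[rotated])
    then have "distinct (map fst (path i))" using strict_sorted_iff by blast
    then show "length (path i) = card (set (path i))" "inj_on fst (set (path i))"
      by (auto simp: distinct_map distinct_card)
  qed
  have disj: "set (path i) \<inter> set (path j) = {}" if "i \<noteq> j" for i j
  proof -
    have "x ` {p \<in> {1..n}. f p = i} \<inter> x ` {p \<in> {1..n}. f p = j} =
        x ` ({p \<in> {1..n}. f p = i} \<inter> {p \<in> {1..n}. f p = j})"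
      by (rule inj_on_image_Int[OF x_inj, symmetric]) auto
    also have "{p \<in> {1..n}. f p = i} \<inter> {p \<in> {1..n}. f p = j} = {}" using that by blast
    finally show ?thesis unfolding set_path by simp
  qed
  have sub: "set (path i) \<subseteq> ?D" for i unfolding set_path using x_mem by auto
  have "card {p \<in> {1..n}. f p < k} = card (\<Union>i\<in>{..<k}. {p \<in> {1..n}. f p = i})"
    by (rule arg_cong[where f = card]) auto
  also have "\<dots> = (\<Sum>i<k. card {p \<in> {1..n}. f p = i})"
    by (intro card_UN_disjoint) auto
  also have "\<dots> = (\<Sum>i<k. card (set (path i)))"
    unfolding set_path by (intro sum.cong refl card_image[symmetric] inj_on_subset[OF x_inj]) auto
  finally have total: "(\<Sum>m\<leftarrow>lam. min k m) \<le> (\<Sum>i<k. card (set (path i)))"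
    using f(2) by simp
  have ne: "path i \<noteq> []" if i: "i < k" for i
  proof
    assume empty: "path i = []"
    let ?I = "{..<k} - {i}"
    \<comment> \<open>Otherwise the remaining paths would be too long: a row with \<open>k\<close> nodes needs \<open>k\<close> paths.\<close>
    have "(\<Sum>j<k. card (set (path j))) = (\<Sum>j\<in>?I. card (set (path j)))"
      using i empty by (simp add: sum.remove[of "{..<k}" i])
    also have "\<dots> \<le> (\<Sum>m\<leftarrow>lam. min (card ?I) m)"
    proof (rule disjoint_sets_bound[OF D(2)])
      show "inj_on fst (set (path j))" if "j \<in> ?I" for j using len(2)[of j] that by blast
    qed (use sub disj in simp_all)
    also have "\<dots> < (\<Sum>m\<leftarrow>lam. min k m)"
    proof -
      have "Max (set lam) \<in> set lam" using lam(2) by simp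
      then obtain xs y ys where y: "lam = xs @ y # ys" "y = Max (set lam)"
        using split_list by metis
      have "card ?I < k" using i by simp
      then have "(\<Sum>m\<leftarrow>zs. min (card ?I) m) \<le> (\<Sum>m\<leftarrow>zs. min k m)" for zs
        by (intro sum_list_mono) auto
      from this[of xs] this[of ys] show ?thesis
        using k i unfolding y(2)[symmetric] by (simp add: y(1))
    qed
    finally show False using total by simp
  qed
  have "is_path ?D (path i)" if "i < k" for i
    using ne[OF that] sub sorted[OF that] by (simp add: is_path_iff_sorted_wrt)
  then have kpath: "is_k_path ?D k (map path [0..<k])"
    using disj by (auto simp: is_k_path_def)
  have "sum_list (map length (map path [0..<k])) = (\<Sum>i<k. card (set (path i)))"
    using len(1) by (simp add: sum_list_sum_nth atLeast0LessThan)
  moreover have "sum_list (map length (map path [0..<k])) \<in> k_path_lengths ?D k"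
    using kpath unfolding k_path_lengths_def by blast
  ultimately have mem: "(\<Sum>i<k. card (set (path i))) \<in> k_path_lengths ?D k" by simp
  then have "(\<Sum>i<k. card (set (path i))) = (\<Sum>m\<leftarrow>lam. min k m)"
    using k_path_length_le[OF D(2)[OF] mem] total by simp
  then show ?thesis using mem by simp
qed

text \<open>Membership in \<^const>\<open>Z_set\<close> makes a diagram admissible.\<close>

lemma admissible_drawing:
  assumes lam: "composition lam n" "lam \<noteq> []" and d: "d \<in> Z_set lam"
    and kap: "column_labelling lam d kap"
  shows "admissible (drawing lam d kap)"
proof -
  have "block_increasing lam d" using d by (auto simp: Z_set_eq[OF lam(1)])
  note D = drawing_diagram[OF lam this kap]
  have "row_comp (drawing lam d kap) = lam" "diagram (drawing lam d kap)"
    using D(2) by (auto simp: diagrams_of_def)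
  then show ?thesis
    unfolding admissible_def has_subseq_type_def
    using is_partition_conjugate[OF lam] D(6) k_path_exists[OF assms] k_path_length_le[OF D(2)]
    by (auto simp: sum_list_take_conjugate[OF lam(2)] length_conjugate)
qed

text \<open>
  In an admissible diagram some path meets every row. A node appended below the only node of the
  last row hence cannot lie to the left of it.
\<close>

lemma admissible_append_node_imp:
  assumes D: "D \<in> diagrams_of lam" and lam: "lam \<noteq> []"
    and last: "\<And>x. x \<in> D \<Longrightarrow> fst x = length lam \<Longrightarrow> snd x = c"
    and adm: "admissible (append_node D b)"
  shows "c \<le> b"
proof -
  let ?D = "append_node D b" and ?r = "length lam"
  note D' = diagrams_of_rows[OF D]
  have D_eq: "?D = insert (Suc ?r, b) D" by (simp add: append_node_def D'(3))
  have fst: "fst ` ?D = {1..Suc ?r}" using D'(2) by (auto simp: D_eq)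
  define ks where "ks = row_comp ?D"
  have E: "?D \<in> diagrams_of ks" using adm by (simp add: admissible_def diagrams_of_def ks_def)
  note E' = diagrams_of_rows[OF E]
  have len: "length ks = Suc ?r" using E'(2) fst by (metis card_atLeastAtMost diff_Suc_1)
  have ks: "has_subseq_type ?D (conjugate ks)" using adm by (simp add: admissible_def ks_def)
  have pos: "1 \<le> m" if m: "m \<in> set ks" for m
  proof -
    obtain a where a: "a < length ks" "ks ! a = m" using m by (auto simp: in_set_conv_nth)
    then have "Suc a \<in> fst ` ?D" using E'(2) by simp
    then have "{x \<in> ?D. fst x = Suc a} \<noteq> {}" by auto
    then have "card {x \<in> ?D. fst x = Suc a} \<noteq> 0" using E'(1) by simp
    then show ?thesis using E'(6)[of "Suc a"] a by simp
  qed
  have ks_ne: "ks \<noteq> []" using len by auto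
  then have "1 \<le> Max (set ks)" using pos Max_in[of "set ks"] by simp
  then have "(\<Sum>m\<leftarrow>ks. min 1 m) \<in> k_path_lengths ?D 1"
    using ks sum_list_take_conjugate[OF ks_ne, of 1] length_conjugate[of ks]
    unfolding has_subseq_type_def by (metis atLeastAtMost_iff order_refl)
  moreover have "(\<Sum>m\<leftarrow>ks. min 1 m) = (\<Sum>m\<leftarrow>ks. 1)"
    using pos by (intro arg_cong[where f = sum_list] map_cong) auto
  ultimately have "Suc ?r \<in> k_path_lengths ?D 1" using len by (simp add: sum_list_triv)
  then obtain ps where "is_k_path ?D 1 ps" "Suc ?r = sum_list (map length ps)"
    by (auto simp: k_path_lengths_def)
  then obtain p where p: "is_path ?D p" "length p = Suc ?r"
    by (auto simp: is_k_path_def length_Suc_conv)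
  have "set (map fst p) = {1..Suc ?r}"
  proof (rule card_subset_eq)
    show "set (map fst p) \<subseteq> {1..Suc ?r}" using p(1) fst by (auto simp: is_path_def)
    show "card (set (map fst p)) = card {1..Suc ?r}"
      using distinct_card[OF path_distinct_fst[OF p(1)]] p(2) by simp
  qed simp
  moreover have "?r \<in> {1..Suc ?r}" using lam by (cases lam) auto
  moreover have "Suc ?r \<in> {1..Suc ?r}" by simp
  ultimately have "?r \<in> fst ` set p" "Suc ?r \<in> fst ` set p" by simp_all
  then obtain x y where x: "x \<in> set p" "fst x = ?r" and y: "y \<in> set p" "fst y = Suc ?r"
    by (elim imageE) simp
  have "set p \<subseteq> ?D" and sorted: "sorted_wrt (\<lambda>x y. fst x < fst y \<and> snd x \<le> snd y) p"
    using p(1) by (auto simp: is_path_iff_sorted_wrt)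
  then have "x \<in> D" "y = (Suc ?r, b)" using x y D'(2) unfolding D_eq by force+
  obtain i j where ij: "i < length p" "p ! i = x" "j < length p" "p ! j = y"
    using x(1) y(1) by (auto simp: in_set_conv_nth)
  have "i < j"
  proof (rule ccontr)
    assume "\<not> i < j"
    moreover have "i \<noteq> j" using ij x y by auto
    ultimately have "fst y < fst x" using sorted_wrt_nth_less[OF sorted, of j i] ij by simp
    then show False using x y by simp
  qed
  then have "snd x \<le> snd y" using sorted_wrt_nth_less[OF sorted, of i j] ij by simp
  then show ?thesis using last[OF \<open>x \<in> D\<close> x(2)] \<open>y = _\<close> by simp
qed

section \<open>The bijection\<close>

lemma diag_perm_psi:
  assumes lam: "composition lam n" "lam = mu @ [1]"
    and D: "D \<in> diagrams_of lam" "diag_perm D \<in> Z_set lam"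
  shows "diag_perm (psi D) = append_next n (diag_perm D)"
proof -
  let ?d = "diag_perm D" and ?lam' = "lam @ [1]"
  have n: "n = sum_list lam" using lam by (simp add: composition_def)
  have ne: "lam \<noteq> []" using lam by simp
  have n1: "n \<in> {1..n}" using n lam(2) by simp
  have lam': "composition ?lam' (Suc n)" using lam(1) by (simp add: composition_def)
  have d: "block_increasing lam ?d" using D(2) by (simp add: Z_set_eq[OF lam(1)])
  have perm: "?d permutes {1..n}" using d n by (simp add: block_increasing_def)
  obtain kap where kap: "column_labelling lam ?d kap" "D = drawing lam ?d kap"
    using diagram_is_drawing[OF n perm D(1) refl] by blast
  obtain kap' where kap': "column_labelling ?lam' (append_next n ?d) kap'"
    "append_node D (kap (?d n)) = drawing ?lam' (append_next n ?d) kap'"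
    using append_node_eq_drawing[OF lam d kap(1)] kap(2) by metis
  have "?d n \<in> {1..n}" using permutes_in_image[OF perm] n1 by blast
  then have append_next: "append_next n ?d \<in> Z_set ?lam'"
    using append_value_in_Z_set_iff[OF lam perm, of "Suc (?d n)"] D(2) by (simp add: append_next_def)
  then have append_next_inc: "block_increasing ?lam' (append_next n ?d)" unfolding Z_set_eq[OF lam'] by blast
  have adm: "admissible (append_node D (kap (?d n)))"
    unfolding kap'(2) using admissible_drawing[OF lam' _ append_next kap'(1)] by simp
  have last: "snd x = kap (?d n)" if x: "x \<in> D" "fst x = length lam" for x
  proof -
    obtain p where p: "p \<in> {1..n}" "x = node_at lam ?d kap p"
      using x(1) unfolding kap(2)[symmetric] by (subst (asm) kap(2)) (auto simp: drawing_def n)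
    have "blk lam p = Suc (length mu)" using x(2) p lam(2) by (simp add: node_at_def)
    then have "p = n"
      using p(1) n blk_le_length[of p mu] unfolding lam(2) by (auto simp: blk_snoc split: if_splits)
    then show ?thesis using p by (simp add: node_at_def)
  qed
  have "(LEAST b. admissible (append_node D b)) = kap (?d n)"
    using adm admissible_append_node_imp[OF D(1) ne last] by (intro Least_equality)
  then have "psi D = drawing ?lam' (append_next n ?d) kap'" unfolding psi_def using kap'(2) by simp
  then show ?thesis using drawing_diagram(3)[OF lam' _ append_next_inc kap'(1)] by simp
qed

text \<open>Whichever diagram represents \<open>d\<close>, the result is \<open>d\<close> with the next value appended.\<close>

lemma theta_star_eq:
  assumes lam: "composition lam n" "lam = mu @ [1]" and d: "d \<in> Y_set lam"
  shows "theta_star lam d = append_next n d"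
proof -
  have ne: "lam \<noteq> []" using lam by simp
  have min: "min_diagram y lam \<in> diagrams_of lam \<and> diag_perm (min_diagram y lam) = y"
    if "y \<in> Y_set lam" for y
  proof -
    have y: "block_increasing lam y" using that by (auto simp: Y_set_def Z_set_eq[OF lam(1)])
    then have "column_labelling lam y (min_labelling lam y)"
      by (intro column_labelling_min) (simp add: block_increasing_def)
    from drawing_diagram(2,3)[OF lam(1) ne y this] show ?thesis
      by (simp add: min_diagram_eq[OF lam(1) ne y])
  qed
  let ?D = "inv_into (E_set lam) diag_perm d"
  have "d \<in> diag_perm ` E_set lam"
    using min[OF d] d by (force simp: E_set_def image_image)
  then have "?D \<in> E_set lam" "diag_perm ?D = d" by (simp_all add: inv_into_into f_inv_into_f)
  moreover from this have "?D \<in> diagrams_of lam" using min by (auto simp: E_set_def)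
  ultimately show ?thesis
    using diag_perm_psi[OF lam, of ?D] d by (simp add: theta_star_def Y_set_def)
qed

theorem proposition4p2:
  fixes r n :: nat and lam :: "nat list"
  assumes "r \<ge> 2"
    and "n \<ge> 2"
    and "composition lam n"
    and "length lam = r"
    and "lam ! (r - 1) = 1"
  shows "bij_betw (theta_star lam) (Y_set lam) (Y_set (lam @ [1]))"
proof -
  have "lam = butlast lam @ [1]"
    using assms by (metis append_butlast_last_id last_conv_nth list.size(3) not_numeral_le_zero)
  note lam = assms(3) this
  show ?thesis
    using bij_betw_append_next[OF lam] theta_star_eq[OF lam] by (simp cong: bij_betw_cong)
qed

end
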